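(* One can construct a parsimonious polynomial-time reduction from 3Sat to ExistLIS (with $E=2$): each instance $x$ of 3Sat with input size $k$ can be transformed within polynomial time to an instance $y=T(x)$ of ExistLIS with $E=2$ and dimension $d=7k+1$ such that $|\mathcal S_y|=|\mathcal S_x|$.
   Context: 3Sat instance: a conjunctive normal form $\bigwedge_{i=1}^k(l_{i,1}\lor l_{i,2}\lor l_{i,3})$ with $k$ clauses, where each literal $l_{i,u}$ is either $v_\ell$ or $\neg v_\ell$ for some boolean variable $v_\ell\in\{\mathrm{True},\mathrm{False}\}$ with $\ell\in[n]=\{1,\dots,n\}$. The question is whether there is an assignment of the variables making the formula True. The input size is $k$. $\mathcal S_x\subseteq\{\mathrm{True},\mathrm{False}\}^n$ denotes the set of assignments of $(v_\ell)_{\ell=1}^n$ making the formula True. ExistLIS instance with $E=2$: a dimension $d\ge1$, positive definite matrices $\Sigma^{(1)},\Sigma^{(2)}\in\mathbb R^{d\times d}$ and vectors $u^{(1)},u^{(2)}\in\mathbb R^d$. For $S\subseteq[d]$ let $\beta^{(e,S)}\in\mathbb R^d$ be given by $\beta^{(e,S)}_S=(\Sigma^{(e)}_S)^{-1}u^{(e)}_S$, $\beta^{(e,S)}_{S^c}=0$, where $\Sigma_S^{(e)}$ is the principal submatrix and $u_S^{(e)}$ the subvector indexed by $S$. The solution set $\mathcal S_y$ of the instance $y$ is the set of all $S\subseteq[d]$ with $\beta^{(1,S)}=\beta^{(2,S)}\ne0$; the question is whether $\mathcal S_y$ is non-empty.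
   Formalization: Every variable v_1,…,v_n is assumed to occur in some clause; otherwise the claim fails, e.g. k=1, n=100 gives |S_x|=7·2^97, which exceeds the at most 2^8 possible sets S. *)

theory Defs
  imports
    Complex_Main
    "HOL-Library.FuncSet"
    "HOL-Computational_Algebra.Polynomial"
    "Jordan_Normal_Form.Gauss_Jordan_Elimination"
    "Jordan_Normal_Form.DL_Submatrix"
begin

section \<open>3Sat\<close>

datatype literal = Pos nat | Neg nat

fun literal_var :: "literal \<Rightarrow> nat" where
  "literal_var (Pos l) = l"
| "literal_var (Neg l) = l"

fun literal_true :: "(nat \<Rightarrow> bool) \<Rightarrow> literal \<Rightarrow> bool" where
  "literal_true v (Pos l) = v l"
| "literal_true v (Neg l) = (\<not> v l)"

type_synonym clause = "literal \<times> literal \<times> literal"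

fun clause_vars :: "clause \<Rightarrow> nat set" where
  "clause_vars (l1, l2, l3) = {literal_var l1, literal_var l2, literal_var l3}"

fun clause_true :: "(nat \<Rightarrow> bool) \<Rightarrow> clause \<Rightarrow> bool" where
  "clause_true v (l1, l2, l3) = (literal_true v l1 \<or> literal_true v l2 \<or> literal_true v l3)"

record sat3 =
  num_vars :: nat
  clauses :: "clause list"

text \<open>The variables \<open>v\<^sub>1, \<dots>, v\<^sub>n\<close> of a formula are exactly those that occur in
  it.  This is what makes the number \<open>k\<close> of clauses a legitimate input size: then \<open>n \<le> 3 k\<close>.
  (With unboundedly many unused variables, the number of satisfying assignments would not be
  bounded in terms of \<open>k\<close> at all.)  A clause may repeat a variable.\<close>

definition sat3_instance :: "sat3 \<Rightarrow> bool" where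
  "sat3_instance x \<longleftrightarrow> (\<Union>c\<in>set (clauses x). clause_vars c) = {1..num_vars x}"

definition sat3_size :: "sat3 \<Rightarrow> nat" where
  "sat3_size x = length (clauses x)"

text \<open>Elements of \<open>{True, False}\<^sup>n\<close> are functions on \<open>{1..n}\<close> (with the fixed value
  \<^term>\<open>undefined\<close> elsewhere, so that each assignment is counted once).\<close>

definition sat3_solutions :: "sat3 \<Rightarrow> (nat \<Rightarrow> bool) set" where
  "sat3_solutions x =
     {v \<in> {1..num_vars x} \<rightarrow>\<^sub>E UNIV. \<forall>c\<in>set (clauses x). clause_true v c}"


section \<open>ExistLIS with two environments\<close>

text \<open>Only the environments \<open>e = 1\<close> and \<open>e = 2\<close> are relevant.  Coordinates are
  numbered \<open>0, \<dots>, d - 1\<close>, as is usual for the matrices of the library.\<close>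

record exist_lis =
  lis_dim :: nat
  lis_Sigma :: "nat \<Rightarrow> real mat"
  lis_u :: "nat \<Rightarrow> real vec"

definition positive_definite :: "nat \<Rightarrow> real mat \<Rightarrow> bool" where
  "positive_definite d A \<longleftrightarrow>
     A \<in> carrier_mat d d \<and> transpose_mat A = A \<and>
     (\<forall>x\<in>carrier_vec d. x \<noteq> 0\<^sub>v d \<longrightarrow> x \<bullet> (A *\<^sub>v x) > 0)"

definition exist_lis_instance :: "exist_lis \<Rightarrow> bool" where
  "exist_lis_instance y \<longleftrightarrow>
     lis_dim y \<ge> 1 \<and>
     (\<forall>e\<in>{1, 2}. positive_definite (lis_dim y) (lis_Sigma y e) \<and>
                 lis_u y e \<in> carrier_vec (lis_dim y))"

text \<open>\<^term>\<open>pick S a\<close> is the \<open>a\<close>-th smallest element of \<open>S\<close>, as in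
  \<^const>\<open>submatrix\<close>.\<close>

definition subvector :: "'a vec \<Rightarrow> nat set \<Rightarrow> 'a vec" where
  "subvector u S = vec (card {i. i < dim_vec u \<and> i \<in> S}) (\<lambda>a. u $ pick S a)"

definition lis_beta :: "exist_lis \<Rightarrow> nat \<Rightarrow> nat set \<Rightarrow> real vec" where
  "lis_beta y e S =
     (let b = the (mat_inverse (submatrix (lis_Sigma y e) S S)) *\<^sub>v subvector (lis_u y e) S
      in vec (lis_dim y) (\<lambda>i. if i \<in> S then b $ card {j \<in> S. j < i} else 0))"

definition lis_solutions :: "exist_lis \<Rightarrow> nat set set" where
  "lis_solutions y =
     {S. S \<subseteq> {..<lis_dim y} \<and>
         lis_beta y 1 S = lis_beta y 2 S \<and> lis_beta y 1 S \<noteq> 0\<^sub>v (lis_dim y)}"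


section \<open>Polynomial time\<close>

text \<open>The machine model is the random access machine with a read-only input tape, a write-only
  output tape and a memory of natural numbers.  The only arithmetic operations are addition and
  (truncated) subtraction, so that a number held after \<open>t\<close> steps has \<open>O(t)\<close> more bits than the
  input words and the constants of the program; hence counting instructions is polynomially
  equivalent to counting steps of a Turing machine.\<close>

datatype instr =
    Const nat nat      \<comment> \<open>\<open>m[r] := c\<close>\<close>
  | Copy nat nat       \<comment> \<open>\<open>m[r] := m[s]\<close>\<close>
  | Add nat nat nat    \<comment> \<open>\<open>m[r] := m[s] + m[t]\<close>\<close>
  | Sub nat nat nat    \<comment> \<open>\<open>m[r] := m[s] - m[t]\<close>, truncated at \<open>0\<close>\<close>
  | Load nat nat       \<comment> \<open>\<open>m[r] := m[m[s]]\<close>\<close>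
  | Store nat nat      \<comment> \<open>\<open>m[m[r]] := m[s]\<close>\<close>
  | Read nat           \<comment> \<open>next input word, or \<open>0\<close> at the end of the input, into \<open>m[r]\<close>\<close>
  | Write nat          \<comment> \<open>append \<open>m[r]\<close> to the output\<close>
  | Jump nat
  | JumpZero nat nat   \<comment> \<open>jump to instruction \<open>l\<close> if \<open>m[r] = 0\<close>\<close>

record config =
  cfg_pc :: nat
  cfg_mem :: "nat \<Rightarrow> nat"
  cfg_in :: "nat list"
  cfg_out :: "nat list"

fun exec :: "instr \<Rightarrow> config \<Rightarrow> config" where
  "exec (Const r c) s = s\<lparr>cfg_mem := (cfg_mem s)(r := c), cfg_pc := cfg_pc s + 1\<rparr>"
| "exec (Copy r a) s = s\<lparr>cfg_mem := (cfg_mem s)(r := cfg_mem s a), cfg_pc := cfg_pc s + 1\<rparr>"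
| "exec (Add r a b) s =
     s\<lparr>cfg_mem := (cfg_mem s)(r := cfg_mem s a + cfg_mem s b), cfg_pc := cfg_pc s + 1\<rparr>"
| "exec (Sub r a b) s =
     s\<lparr>cfg_mem := (cfg_mem s)(r := cfg_mem s a - cfg_mem s b), cfg_pc := cfg_pc s + 1\<rparr>"
| "exec (Load r a) s =
     s\<lparr>cfg_mem := (cfg_mem s)(r := cfg_mem s (cfg_mem s a)), cfg_pc := cfg_pc s + 1\<rparr>"
| "exec (Store r a) s =
     s\<lparr>cfg_mem := (cfg_mem s)(cfg_mem s r := cfg_mem s a), cfg_pc := cfg_pc s + 1\<rparr>"
| "exec (Read r) s =
     s\<lparr>cfg_mem := (cfg_mem s)(r := (case cfg_in s of [] \<Rightarrow> 0 | w # _ \<Rightarrow> w)),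
       cfg_in := tl (cfg_in s), cfg_pc := cfg_pc s + 1\<rparr>"
| "exec (Write r) s = s\<lparr>cfg_out := cfg_out s @ [cfg_mem s r], cfg_pc := cfg_pc s + 1\<rparr>"
| "exec (Jump l) s = s\<lparr>cfg_pc := l\<rparr>"
| "exec (JumpZero r l) s = s\<lparr>cfg_pc := (if cfg_mem s r = 0 then l else cfg_pc s + 1)\<rparr>"

text \<open>The machine halts when the program counter leaves the program.\<close>

definition halted :: "instr list \<Rightarrow> config \<Rightarrow> bool" where
  "halted P s \<longleftrightarrow> cfg_pc s \<ge> length P"

definition step :: "instr list \<Rightarrow> config \<Rightarrow> config" where
  "step P s = (if halted P s then s else exec (P ! cfg_pc s) s)"

definition initial_config :: "nat list \<Rightarrow> config" where
  "initial_config ws = \<lparr>cfg_pc = 0, cfg_mem = (\<lambda>_. 0), cfg_in = ws, cfg_out = []\<rparr>"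

definition computes_within :: "instr list \<Rightarrow> nat list \<Rightarrow> nat \<Rightarrow> nat list \<Rightarrow> bool" where
  "computes_within P input t output \<longleftrightarrow>
     (let s = (step P ^^ t) (initial_config input) in halted P s \<and> cfg_out s = output)"

text \<open>Outputs are encoded by a relation, since not every object (such as a real matrix with
  irrational entries) needs to have a finite code.\<close>

definition polytime_computable ::
  "('a \<Rightarrow> bool) \<Rightarrow> ('a \<Rightarrow> nat) \<Rightarrow> ('a \<Rightarrow> nat list) \<Rightarrow> ('b \<Rightarrow> nat list \<Rightarrow> bool) \<Rightarrow> ('a \<Rightarrow> 'b) \<Rightarrow> bool"
where
  "polytime_computable valid sz enc_in is_code_out T \<longleftrightarrow>
     (\<exists>P. \<exists>p :: nat poly. \<forall>x. valid x \<longrightarrow>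
        (\<exists>output. computes_within P (enc_in x) (poly p (sz x)) output \<and>
                  is_code_out (T x) output))"


section \<open>Encodings of the instances\<close>

fun literal_code :: "literal \<Rightarrow> nat list" where
  "literal_code (Pos l) = [1, l]"
| "literal_code (Neg l) = [0, l]"

fun clause_code :: "clause \<Rightarrow> nat list" where
  "clause_code (l1, l2, l3) = literal_code l1 @ literal_code l2 @ literal_code l3"

definition sat3_code :: "sat3 \<Rightarrow> nat list" where
  "sat3_code x = num_vars x # length (clauses x) # concat (map clause_code (clauses x))"

text \<open>The code of a rational number consists of its sign, numerator and denominator, in lowest
  terms.\<close>

definition rat_code :: "rat \<Rightarrow> nat list" where
  "rat_code r = (case quotient_of r of (p, q) \<Rightarrow> [if p < 0 then 1 else 0, nat \<bar>p\<bar>, nat q])"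

definition is_real_code :: "real \<Rightarrow> nat list \<Rightarrow> bool" where
  "is_real_code a ws \<longleftrightarrow> (\<exists>r. a = of_rat r \<and> ws = rat_code r)"

definition lis_entries :: "exist_lis \<Rightarrow> nat \<Rightarrow> real list" where
  "lis_entries y e =
     [lis_Sigma y e $$ (i, j). i \<leftarrow> [0..<lis_dim y], j \<leftarrow> [0..<lis_dim y]] @
     [lis_u y e $ i. i \<leftarrow> [0..<lis_dim y]]"

definition is_lis_code :: "exist_lis \<Rightarrow> nat list \<Rightarrow> bool" where
  "is_lis_code y ws \<longleftrightarrow>
     (\<exists>codes. list_all2 is_real_code (lis_entries y 1 @ lis_entries y 2) codes \<and>
              ws = lis_dim y # concat codes)"

end

theory Submission
  imports Defs "Jordan_Normal_Form.Determinant"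
begin

text \<open>Take \<open>\<Sigma>\<close> to be the identity and \<open>u\<close> the all-ones vector for \<open>e = 1\<close>.  Then \<open>\<beta>\<close> is the indicator
  vector of \<open>S\<close>, and the two vectors \<open>\<beta>\<close> agree iff every row \<open>i \<in> S\<close> of the matrix for \<open>e = 2\<close>, summed
  over the columns in \<open>S\<close>, gives \<open>u\<^sub>i\<close>.  The coordinates are one special coordinate \<open>0\<close> and, for each
  clause, seven slots, one per way of satisfying the three literals.  Apart from a large diagonal term,
  which makes the matrix positive definite, the entry between two slots is twice the number of
  pairs of complementary literals, and the entry between \<open>0\<close> and a slot is \<open>1\<close>.  If the row sum of a slot
  has to be \<open>1\<close>, parity forces \<open>0 \<in> S\<close> and forbids conflicts inside \<open>S\<close>; the row of \<open>0\<close> forces \<open>S\<close> to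
  contain \<open>k\<close> slots.  As slots of the same clause conflict, \<open>S\<close> consists of \<open>0\<close> and one slot per clause,
  consistently chosen, which is the same as a satisfying assignment.\<close>

section \<open>The vectors \<open>\<beta>\<close>\<close>

lemma bij_betw_pick:
  assumes "finite S"
  shows "bij_betw (pick S) {..<card S} S"
proof (rule bij_betw_byWitness[where f' = "\<lambda>i. card {a\<in>S. a < i}"])
  show "\<forall>a\<in>{..<card S}. card {x\<in>S. x < pick S a} = a"
    using card_pick_le by simp
  show "\<forall>i\<in>S. pick S (card {a\<in>S. a < i}) = i"
    using pick_card_in_set by simp
  show "pick S ` {..<card S} \<subseteq> S"
    using pick_in_set_le by auto
  show "(\<lambda>i. card {a\<in>S. a < i}) ` S \<subseteq> {..<card S}"
    using assms by (auto intro!: psubset_card_mono)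
qed

text \<open>Positive definiteness makes every principal submatrix invertible, so
  \<open>lis_beta y e S\<close> is the only vector supported on \<open>S\<close> that solves the
  equations of the rows in \<open>S\<close>. This removes inverses and the renumbering by
  \<open>pick\<close> from all that follows.\<close>

lemma lis_beta_eq_iff:
  assumes y: "exist_lis_instance y" and e: "e \<in> {1, 2}" and S: "S \<subseteq> {..<lis_dim y}"
    and g: "g \<in> carrier_vec (lis_dim y)" "\<And>i. i < lis_dim y \<Longrightarrow> i \<notin> S \<Longrightarrow> g $ i = 0"
  shows "lis_beta y e S = g \<longleftrightarrow> (\<forall>i\<in>S. (\<Sum>j\<in>S. lis_Sigma y e $$ (i, j) * g $ j) = lis_u y e $ i)"
proof -
  define d where "d = lis_dim y"
  define A where "A = lis_Sigma y e"
  define u where "u = lis_u y e"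
  define n where "n = card S"
  define M where "M = submatrix A S S"
  \<comment> \<open>\<open>rk\<close> inverts \<open>pick S\<close>; it is the index that
    \<open>lis_beta\<close> uses to spread the short vector over all coordinates.\<close>
  define rk where "rk i = card {a\<in>S. a < i}" for i
  have fin: "finite S" using S finite_subset by blast
  have A: "A \<in> carrier_mat d d" and pos: "\<And>x. x \<in> carrier_vec d \<Longrightarrow> x \<noteq> 0\<^sub>v d \<Longrightarrow> x \<bullet> (A *\<^sub>v x) > 0"
    and u: "u \<in> carrier_vec d"
    using y e by (auto simp: exist_lis_instance_def positive_definite_def A_def d_def u_def)
  have cardS: "card {i. i < d \<and> i \<in> S} = n"
  proof -
    have "{i. i < d \<and> i \<in> S} = S" using S d_def by auto
    then show ?thesis by (simp add: n_def)
  qed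
  have bij: "bij_betw (pick S) {..<n} S"
    using bij_betw_pick[OF fin] by (simp add: n_def)
  have pick: "a < n \<Longrightarrow> pick S a \<in> S" "a < n \<Longrightarrow> pick S a < d" for a
    using bij S by (auto simp: bij_betw_def d_def)
  have rk_pick: "rk (pick S a) = a" if "a < n" for a
    using that card_pick_le by (simp add: rk_def n_def)
  have pick_rk: "pick S (rk i) = i" if "i \<in> S" for i
    using that pick_card_in_set by (simp add: rk_def)
  have rk_less: "rk i < n" if "i \<in> S" for i
    unfolding rk_def n_def using that fin by (intro psubset_card_mono) auto
  have M: "M \<in> carrier_mat n n"
    by (rule carrier_matI) (use A cardS in \<open>simp_all add: M_def dim_submatrix\<close>)
  have M_index: "M $$ (a, b) = A $$ (pick S a, pick S b)" if "a < n" "b < n" for a b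
    unfolding M_def using that A cardS by (intro submatrix_index) auto
  have sum_pick: "(\<Sum>a<n. f (pick S a)) = (\<Sum>i\<in>S. f i)" for f :: "nat \<Rightarrow> real"
    using sum.reindex_bij_betw[OF bij] .
  have mult: "(M *\<^sub>v x) $ a = (\<Sum>j\<in>S. A $$ (pick S a, j) * x $ rk j)" if "x \<in> carrier_vec n" "a < n" for x a
  proof -
    have "(M *\<^sub>v x) $ a = (\<Sum>b<n. M $$ (a, b) * x $ b)"
      using that M by (auto simp: scalar_prod_def atLeast0LessThan intro!: sum.cong)
    also have "\<dots> = (\<Sum>b<n. A $$ (pick S a, pick S b) * x $ rk (pick S b))"
      using that M_index rk_pick by (intro sum.cong) auto
    finally show ?thesis using sum_pick[of "\<lambda>j. A $$ (pick S a, j) * x $ rk j"] by simp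
  qed
  have "det M \<noteq> 0"
  proof
    assume "det M = 0"
    then obtain x where x: "x \<in> carrier_vec n" "x \<noteq> 0\<^sub>v n" "M *\<^sub>v x = 0\<^sub>v n"
      using det_0_iff_vec_prod_zero_field[OF M] by auto
    \<comment> \<open>A kernel vector of \<open>M\<close>, extended by zero, gives the quadratic
      form of \<open>A\<close> the value 0: inside \<open>S\<close> its image vanishes, outside
      \<open>S\<close> it vanishes itself.\<close>
    define z where "z = vec d (\<lambda>i. if i \<in> S then x $ rk i else 0)"
    have z: "z \<in> carrier_vec d" by (simp add: z_def)
    obtain a where a: "a < n" "x $ a \<noteq> 0"
      using x(1,2) by (metis carrier_vecD dim_vec eq_vecI index_zero_vec(1) zero_carrier_vec)
    then have "z $ pick S a \<noteq> 0" using pick rk_pick by (simp add: z_def)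
    then have "z \<noteq> 0\<^sub>v d" using pick a by auto
    then have "z \<bullet> (A *\<^sub>v z) > 0" using pos z by blast
    moreover have "z $ i * (A *\<^sub>v z) $ i = 0" if "i < d" for i
    proof (cases "i \<in> S")
      case True
      have "(A *\<^sub>v z) $ i = (\<Sum>j<d. A $$ (i, j) * z $ j)"
        using that A z by (auto simp: scalar_prod_def atLeast0LessThan intro!: sum.cong)
      also have "\<dots> = (\<Sum>j\<in>S. A $$ (i, j) * x $ rk j)"
        using S by (intro sum.mono_neutral_cong_right) (auto simp: z_def d_def)
      also have "\<dots> = (M *\<^sub>v x) $ rk i"
        using mult[OF x(1) rk_less[OF True]] pick_rk[OF True] by simp
      finally show ?thesis using x(3) rk_less[OF True] by simp
    qed (simp add: z_def that)
    moreover have "z \<bullet> (A *\<^sub>v z) = (\<Sum>i = 0..<d. z $ i * (A *\<^sub>v z) $ i)"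
      using A by (simp add: scalar_prod_def)
    ultimately show False by simp
  qed
  \<comment> \<open>Hence \<open>mat_inverse\<close> does not return \<open>None\<close>, and
    \<open>the\<close> in \<open>lis_beta\<close> yields the true inverse.\<close>
  then have "M \<in> Units (ring_mat TYPE(real) n ())"
    by (rule det_non_zero_imp_unit[OF M])
  then obtain B where "mat_inverse M = Some B"
    using mat_inverse(1)[OF M, where b = "()"] by blast
  note B = this mat_inverse(2)[OF M this]
  define w where "w = subvector u S"
  have w: "w \<in> carrier_vec n" "\<And>a. a < n \<Longrightarrow> w $ a = u $ pick S a"
    using u cardS by (auto simp: w_def subvector_def)
  have beta: "lis_beta y e S = vec d (\<lambda>i. if i \<in> S then (B *\<^sub>v w) $ rk i else 0)"
    using B(1) by (simp only: lis_beta_def M_def A_def w_def u_def d_def rk_def option.sel Let_def)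
  \<comment> \<open>\<open>h\<close> is \<open>g\<close> compressed to the coordinates in
    \<open>S\<close>; outside \<open>S\<close> both \<open>g\<close> and \<open>lis_beta\<close> are
    zero.\<close>
  define h where "h = vec n (\<lambda>a. g $ pick S a)"
  have h: "h \<in> carrier_vec n" by (simp add: h_def)
  have "lis_beta y e S = g \<longleftrightarrow> B *\<^sub>v w = h"
  proof
    assume eq: "lis_beta y e S = g"
    show "B *\<^sub>v w = h"
    proof (rule eq_vecI)
      fix a assume "a < dim_vec h"
      then have a: "a < n" by (simp add: h_def)
      have "lis_beta y e S $ pick S a = (B *\<^sub>v w) $ a"
        using a pick rk_pick by (simp add: beta)
      then show "(B *\<^sub>v w) $ a = h $ a" using a eq by (simp add: h_def)
    qed (use B in \<open>auto simp: h_def\<close>)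
  next
    assume eq: "B *\<^sub>v w = h"
    show "lis_beta y e S = g"
      unfolding beta eq
      by (rule eq_vecI) (use g rk_less pick_rk in \<open>auto simp: h_def d_def\<close>)
  qed
  also have "\<dots> \<longleftrightarrow> M *\<^sub>v h = w"
    using B M w h by (metis assoc_mult_mat_vec one_mult_mat_vec)
  also have "\<dots> \<longleftrightarrow> (\<forall>a<n. (M *\<^sub>v h) $ a = w $ a)"
    using M w(1) by (auto intro!: eq_vecI)
  also have "\<dots> \<longleftrightarrow> (\<forall>a<n. (\<Sum>j\<in>S. A $$ (pick S a, j) * g $ j) = u $ pick S a)"
  proof -
    have "(M *\<^sub>v h) $ a = (\<Sum>j\<in>S. A $$ (pick S a, j) * g $ j)" if "a < n" for a
      unfolding mult[OF h that] using rk_less pick_rk by (intro sum.cong) (auto simp: h_def)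
    then show ?thesis using w by auto
  qed
  also have "\<dots> \<longleftrightarrow> (\<forall>i\<in>S. (\<Sum>j\<in>S. A $$ (i, j) * g $ j) = u $ i)"
    using pick pick_rk rk_less by metis
  finally show ?thesis by (simp add: A_def u_def)
qed

section \<open>Instances with natural-number entries\<close>

definition lis_of_nats :: "nat \<Rightarrow> (nat \<Rightarrow> nat \<Rightarrow> nat \<Rightarrow> nat) \<Rightarrow> (nat \<Rightarrow> nat \<Rightarrow> nat) \<Rightarrow> exist_lis" where
  "lis_of_nats d a b = \<lparr>lis_dim = d, lis_Sigma = (\<lambda>e. mat d d (\<lambda>(i, j). real (a e i j))),
                        lis_u = (\<lambda>e. vec d (\<lambda>i. real (b e i)))\<rparr>"

text \<open>Since \<open>-2 a b \<le> a^2 + b^2\<close>, a symmetric matrix with entries between 0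
  and \<open>c\<close> has quadratic form at least \<open>- d c |x|^2\<close>, which the diagonal
  term \<open>D |x|^2\<close> outweighs.\<close>

lemma positive_definite_diag_dominant:
  assumes sym: "\<And>i j. i < d \<Longrightarrow> j < d \<Longrightarrow> A i j = A j i"
    and bounds: "\<And>i j. i < d \<Longrightarrow> j < d \<Longrightarrow> A i j \<le> c" and D: "d * c < D"
  shows "positive_definite d (mat d d (\<lambda>(i, j). real (D * of_bool (i = j) + A i j)))"
    (is "positive_definite d ?M")
  unfolding positive_definite_def
proof (intro conjI ballI impI)
  show "transpose_mat ?M = ?M"
    by (rule eq_matI) (auto simp: sym)
  fix x :: "real vec"
  assume x: "x \<in> carrier_vec d" "x \<noteq> 0\<^sub>v d"
  define q where "q = (\<Sum>i<d. (x $ i)\<^sup>2)"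
  obtain a where a: "a < d" "x $ a \<noteq> 0"
    using x by (metis carrier_vecD dim_vec eq_vecI index_zero_vec(1) zero_carrier_vec)
  have "q > 0"
    unfolding q_def using a by (intro sum_pos2[of _ a]) auto
  have entry: "- (c / 2) * ((x $ i)\<^sup>2 + (x $ j)\<^sup>2) \<le> real (A i j) * x $ i * x $ j"
    if "i < d" "j < d" for i j
  proof -
    have "2 * - (x $ i * x $ j) \<le> (x $ i)\<^sup>2 + (x $ j)\<^sup>2"
      using sum_squares_bound[of "- x $ i" "x $ j"] by simp
    then have "real (A i j) * (2 * - (x $ i * x $ j)) \<le> real (A i j) * ((x $ i)\<^sup>2 + (x $ j)\<^sup>2)"
      by (intro mult_left_mono) auto
    also have "\<dots> \<le> real c * ((x $ i)\<^sup>2 + (x $ j)\<^sup>2)"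
      using bounds[OF that] by (intro mult_right_mono) auto
    finally show ?thesis by (simp add: algebra_simps)
  qed
  \<comment> \<open>Each square occurs \<open>2 d\<close> times in the double sum, so the factor
    \<open>c / 2\<close> turns into \<open>d c\<close>.\<close>
  have "(\<Sum>i<d. \<Sum>j<d. - (c / 2) * ((x $ i)\<^sup>2 + (x $ j)\<^sup>2)) = - (c / 2) * (\<Sum>i<d. \<Sum>j<d. (x $ i)\<^sup>2 + (x $ j)\<^sup>2)"
    by (simp only: sum_distrib_left)
  also have "(\<Sum>i<d. \<Sum>j<d. (x $ i)\<^sup>2 + (x $ j)\<^sup>2) = 2 * d * q"
    by (simp add: sum.distrib q_def sum_distrib_left mult.assoc)
  finally have lower: "(\<Sum>i<d. \<Sum>j<d. - (c / 2) * ((x $ i)\<^sup>2 + (x $ j)\<^sup>2)) = - (real (d * c) * q)"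
    by simp
  have "x \<bullet> (?M *\<^sub>v x) = (\<Sum>i<d. x $ i * (\<Sum>j<d. (D * of_bool (i = j) + A i j) * x $ j))"
    using x(1) by (auto simp: scalar_prod_def atLeast0LessThan intro!: sum.cong)
  also have "\<dots> = (\<Sum>i<d. \<Sum>j<d. D * of_bool (i = j) * x $ i * x $ j) + (\<Sum>i<d. \<Sum>j<d. A i j * x $ i * x $ j)"
    by (simp add: sum_distrib_left sum.distrib[symmetric] algebra_simps)
  also have "(\<Sum>i<d. \<Sum>j<d. D * of_bool (i = j) * x $ i * x $ j) = (\<Sum>i<d. D * (x $ i)\<^sup>2)"
  proof (intro sum.cong refl)
    fix i assume "i \<in> {..<d}"
    have "(\<Sum>j<d. D * of_bool (i = j) * x $ i * x $ j) = (\<Sum>j<d. if i = j then D * (x $ i)\<^sup>2 else 0)"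
      by (intro sum.cong) (auto simp: power2_eq_square)
    then show "(\<Sum>j<d. D * of_bool (i = j) * x $ i * x $ j) = D * (x $ i)\<^sup>2"
      using \<open>i \<in> {..<d}\<close> by simp
  qed
  also have "(\<Sum>i<d. D * (x $ i)\<^sup>2) = D * q"
    by (simp add: q_def sum_distrib_left)
  finally have eq: "x \<bullet> (?M *\<^sub>v x) = D * q + (\<Sum>i<d. \<Sum>j<d. A i j * x $ i * x $ j)" .
  have "(\<Sum>i<d. \<Sum>j<d. - (c / 2) * ((x $ i)\<^sup>2 + (x $ j)\<^sup>2)) \<le> (\<Sum>i<d. \<Sum>j<d. A i j * x $ i * x $ j)"
    using entry by (intro sum_mono) auto
  then have "D * q - real (d * c) * q \<le> x \<bullet> (?M *\<^sub>v x)"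
    unfolding eq lower by simp
  moreover have "real (d * c) * q < D * q"
    using D \<open>q > 0\<close> by (intro mult_strict_right_mono) (simp_all only: of_nat_less_iff)
  ultimately show "x \<bullet> (?M *\<^sub>v x) > 0" by simp
qed simp

text \<open>Both environments are compared with one candidate, the indicator vector of
  \<open>S\<close>. The identity matrix produces it for every \<open>S\<close>, so what remains is a
  row sum condition for \<open>e = 2\<close>, stated in \<open>nat\<close> to make parity arguments
  available.\<close>

lemma lis_solutions_identity:
  fixes d :: nat and a :: "nat \<Rightarrow> nat \<Rightarrow> nat \<Rightarrow> nat" and b :: "nat \<Rightarrow> nat \<Rightarrow> nat"
  defines "y \<equiv> lis_of_nats d a b"
  assumes inst: "exist_lis_instance y"
    and a1: "\<And>i j. i < d \<Longrightarrow> j < d \<Longrightarrow> a 1 i j = of_bool (i = j)" and b1: "\<And>i. i < d \<Longrightarrow> b 1 i = 1"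
  shows "lis_solutions y = {S. S \<subseteq> {..<d} \<and> S \<noteq> {} \<and> (\<forall>i\<in>S. (\<Sum>j\<in>S. a 2 i j) = b 2 i)}"
proof -
  have "lis_beta y 1 S = lis_beta y 2 S \<and> lis_beta y 1 S \<noteq> 0\<^sub>v d \<longleftrightarrow>
        S \<noteq> {} \<and> (\<forall>i\<in>S. (\<Sum>j\<in>S. a 2 i j) = b 2 i)" if S: "S \<subseteq> {..<d}" for S
  proof -
    define g :: "real vec" where "g = vec d (\<lambda>i. of_bool (i \<in> S))"
    have fin: "finite S" using S finite_subset by blast
    have dim: "lis_dim y = d" by (simp add: y_def lis_of_nats_def)
    have g: "g \<in> carrier_vec d" "\<And>i. i < d \<Longrightarrow> i \<notin> S \<Longrightarrow> g $ i = 0" by (auto simp: g_def)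
    have *: "(\<Sum>j\<in>S. lis_Sigma y e $$ (i, j) * g $ j) = real (\<Sum>j\<in>S. a e i j)"
      "lis_u y e $ i = real (b e i)" if "i \<in> S" for e i
    proof -
      show "(\<Sum>j\<in>S. lis_Sigma y e $$ (i, j) * g $ j) = real (\<Sum>j\<in>S. a e i j)"
        unfolding of_nat_sum using S that
        by (intro sum.cong) (auto simp: y_def lis_of_nats_def g_def subset_iff)
      show "lis_u y e $ i = real (b e i)"
        using S that by (auto simp: y_def lis_of_nats_def subset_iff)
    qed
    have iff: "lis_beta y e S = g \<longleftrightarrow> (\<forall>i\<in>S. (\<Sum>j\<in>S. a e i j) = b e i)" if "e \<in> {1, 2}" for e
    proof -
      have "lis_beta y e S = g \<longleftrightarrow> (\<forall>i\<in>S. (\<Sum>j\<in>S. lis_Sigma y e $$ (i, j) * g $ j) = lis_u y e $ i)"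
        using S g dim by (intro lis_beta_eq_iff[OF inst that]) simp_all
      also have "\<dots> \<longleftrightarrow> (\<forall>i\<in>S. real (\<Sum>j\<in>S. a e i j) = real (b e i))"
        using * by (intro ball_cong) simp_all
      finally show ?thesis by (simp only: of_nat_eq_iff)
    qed
    have "(\<Sum>j\<in>S. a 1 i j) = b 1 i" if "i \<in> S" for i
    proof -
      have "(\<Sum>j\<in>S. a 1 i j) = (\<Sum>j\<in>S. if i = j then 1 else 0)"
        using a1[of i] S that by (intro sum.cong) (auto simp: subset_iff)
      then show ?thesis using that fin b1 S by auto
    qed
    then have 1: "lis_beta y 1 S = g" using iff[of 1] by simp
    \<comment> \<open>The requirement \<open>\<beta> \<noteq> 0\<close> excludes exactly the empty
      set.\<close>
    have "g = 0\<^sub>v d \<longleftrightarrow> S = {}"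
    proof
      assume "g = 0\<^sub>v d"
      have "i \<notin> S" if "i < d" for i
        using that arg_cong[OF \<open>g = 0\<^sub>v d\<close>, of "\<lambda>v. v $ i"] by (auto simp: g_def split: if_splits)
      then show "S = {}" using S by auto
    qed (auto simp: g_def)
    then show ?thesis using 1 iff[of 2] by auto
  qed
  moreover have "lis_dim y = d" by (simp add: y_def lis_of_nats_def)
  ultimately show ?thesis unfolding lis_solutions_def by auto
qed

section \<open>Slots and conflicts\<close>

fun neg_lit :: "literal \<Rightarrow> literal" where
  "neg_lit (Pos l) = Neg l"
| "neg_lit (Neg l) = Pos l"

text \<open>\<open>orient b l\<close> is the literal saying that \<open>l\<close> has truth value
  \<open>b\<close>.\<close>

definition orient :: "bool \<Rightarrow> literal \<Rightarrow> literal" where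
  "orient b l = (if b then l else neg_lit l)"

text \<open>These are the truth values of three literals that satisfy a clause. They form a list
  because their order fixes the numbering of the coordinates and the layout of the table in the
  program.\<close>

definition patterns :: "(bool \<times> bool \<times> bool) list" where
  "patterns = [(False, False, True), (False, True, False), (False, True, True), (True, False, False),
               (True, False, True), (True, True, False), (True, True, True)]"

text \<open>A clause with a repeated variable also has slots that contain complementary literals; these
  conflict with themselves and hence occur in no solution.\<close>

fun clause_slots :: "clause \<Rightarrow> literal list list" where
  "clause_slots (l1, l2, l3) =
     map (\<lambda>(b1, b2, b3). [orient b1 l1, orient b2 l2, orient b3 l3]) patterns"

text \<open>The variable \<open>0\<close> does not occur in a formula, so the first slot conflicts with no other.\<close>

definition slots :: "clause list \<Rightarrow> literal list list" where
  "slots cs = [Neg 0, Neg 0, Neg 0] # concat (map clause_slots cs)"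

text \<open>A count over pairs of positions instead of a predicate: the program obtains it by adding
  up nine comparisons.\<close>

definition conflicts :: "literal list \<Rightarrow> literal list \<Rightarrow> nat" where
  "conflicts s t = (\<Sum>l\<leftarrow>s. \<Sum>l'\<leftarrow>t. of_bool (l = neg_lit l'))"

section \<open>Lists of equally long blocks, literals and numbering of the slots\<close>

lemma length_concat_uniform:
  assumes "\<forall>ys\<in>set yss. length ys = n"
  shows "length (concat yss) = length yss * n"
  using assms by (induction yss) auto

lemma nth_concat_uniform:
  assumes "\<forall>ys\<in>set yss. length ys = n" "i < length yss" "u < n"
  shows "concat yss ! (n * i + u) = yss ! i ! u"
  using assms
proof (induction yss arbitrary: i)
  case (Cons ys yss)
  then show ?case by (cases i) (auto simp: nth_append)
qed simp

lemma neg_lit_involutive [simp]: "neg_lit (neg_lit l) = l"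
  by (cases l) auto

lemma literal_true_neg_lit [simp]: "literal_true v (neg_lit l) \<longleftrightarrow> \<not> literal_true v l"
  by (cases l) auto

lemma literal_var_neg_lit [simp]: "literal_var (neg_lit l) = literal_var l"
  by (cases l) auto

lemma literal_true_orient [simp]: "literal_true v (orient b l) \<longleftrightarrow> (literal_true v l \<longleftrightarrow> b)"
  by (simp add: orient_def)

lemma literal_var_orient [simp]: "literal_var (orient b l) = literal_var l"
  by (simp add: orient_def)

lemma length_patterns [simp]: "length patterns = 7"
  by (simp add: patterns_def)

lemma distinct_patterns: "distinct patterns"
  by (simp add: patterns_def)

lemma set_patterns: "set patterns = UNIV - {(False, False, False)}"
  by (auto simp: patterns_def)

lemma length_clause_slots [simp]: "length (clause_slots c) = 7"
  by (cases c) simp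

lemma length_slots: "length (slots cs) = 7 * length cs + 1"
  by (simp add: slots_def length_concat_uniform[of _ 7])

lemma slots_0: "slots cs ! 0 = [Neg 0, Neg 0, Neg 0]"
  by (simp add: slots_def)

lemma slots_Suc:
  assumes "c < length cs" "a < 7"
  shows "slots cs ! Suc (7 * c + a) = clause_slots (cs ! c) ! a"
  using nth_concat_uniform[of "map clause_slots cs" 7 c a] assms by (simp add: slots_def)

lemma conflicts_eq_0_iff: "conflicts s t = 0 \<longleftrightarrow> (\<forall>l\<in>set s. \<forall>l'\<in>set t. l \<noteq> neg_lit l')"
  by (auto simp: conflicts_def sum_list_eq_0_iff)

text \<open>Negation is an involution, so being complementary is symmetric. This makes the matrix
  for \<open>e = 2\<close> symmetric.\<close>

lemma conflicts_commute: "conflicts s t = conflicts t s"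
proof -
  have sym: "(l = neg_lit l') = (l' = neg_lit l)" for l l' by auto
  have eq: "conflicts s t = (\<Sum>i<length s. \<Sum>j<length t. of_bool (s ! i = neg_lit (t ! j)))" for s t
    by (simp only: conflicts_def sum_list_sum_nth length_map atLeast0LessThan)
      (intro sum.cong refl, simp add: sum_list_sum_nth atLeast0LessThan)
  show ?thesis
    unfolding eq by (subst sum.swap) (simp only: sym[of "s ! _"])
qed

text \<open>The literals of a slot are all true under \<open>v\<close> exactly if its pattern is the
  triple of truth values of the clause literals, and this triple is not all
  \<open>False\<close>.\<close>

lemma slot_of_satisfied_clause:
  assumes "clause_true v c"
  shows "\<exists>!a. a < 7 \<and> (\<forall>l\<in>set (clause_slots c ! a). literal_true v l)"
proof -
  obtain l1 l2 l3 where c: "c = (l1, l2, l3)" by (cases c)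
  let ?t = "(literal_true v l1, literal_true v l2, literal_true v l3)"
  have "?t \<in> set patterns" using assms c by (simp add: set_patterns)
  then have "\<exists>!a. a < 7 \<and> patterns ! a = ?t"
    using distinct_Ex1[OF distinct_patterns] by simp
  moreover have "(\<forall>l\<in>set (clause_slots c ! a). literal_true v l) \<longleftrightarrow> patterns ! a = ?t" if "a < 7" for a
    using that by (cases "patterns ! a") (auto simp: c)
  ultimately show ?thesis by (metis (no_types, lifting))
qed

lemma clause_true_of_slot:
  assumes "a < 7" "\<forall>l\<in>set (clause_slots c ! a). literal_true v l"
  shows "clause_true v c"
proof -
  have "patterns ! a \<noteq> (False, False, False)"
    using nth_mem[of a patterns] assms(1) set_patterns by auto
  then show ?thesis
    using assms by (cases c; cases "patterns ! a") auto
qed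

text \<open>Different patterns differ at some position, where the two slots carry complementary
  literals.\<close>

lemma slots_of_clause_conflict:
  assumes "a < 7" "a' < 7" "a \<noteq> a'"
  shows "conflicts (clause_slots c ! a) (clause_slots c ! a') \<noteq> 0"
proof -
  have "patterns ! a \<noteq> patterns ! a'"
    using assms nth_eq_iff_index_eq[OF distinct_patterns] by simp
  then show ?thesis
    using assms unfolding conflicts_eq_0_iff
    by (cases c; cases "patterns ! a"; cases "patterns ! a'") (auto simp: orient_def split: if_splits)
qed

text \<open>Orientation keeps the variable, so a single slot fixes the values of all variables of
  its clause; this makes the map from assignments to sets of slots injective.\<close>

lemma slot_vars:
  assumes "a < 7"
  shows "literal_var ` set (clause_slots c ! a) = clause_vars c"
  using assms by (cases c; cases "patterns ! a") auto

text \<open>An assignment is sent to the set of slots whose literals it makes true, which has one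
  slot per satisfied clause. Conversely, \<open>k\<close> slots without conflicts lie in different
  clauses, hence meet every clause, and their literals describe a satisfying assignment.\<close>

lemma card_no_conflicts_sets:
  assumes x: "sat3_instance x"
  shows "card {S. S \<subseteq> {..<7 * sat3_size x + 1} \<and> 0 \<in> S \<and> card S = sat3_size x + 1 \<and>
           (\<forall>i\<in>S. \<forall>j\<in>S. conflicts (slots (clauses x) ! i) (slots (clauses x) ! j) = 0)} =
         card (sat3_solutions x)"
    (is "card ?G = _")
proof -
  define n where "n = num_vars x"
  define cs where "cs = clauses x"
  define k where "k = length cs"
  define L where "L i = set (slots cs ! i)" for i
  \<comment> \<open>With variable 0 set to \<open>False\<close>, the literal \<open>Neg 0\<close> is
    true and slot 0 belongs to every \<open>F v\<close>.\<close>
  define ext where "ext v = (v :: nat \<Rightarrow> bool)(0 := False)" for v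
  define F where "F v = {i. i < 7 * k + 1 \<and> (\<forall>l\<in>L i. literal_true (ext v) l)}" for v
  \<comment> \<open>The index of the clause to which slot \<open>i\<close> belongs; the shift by one
    skips the special coordinate.\<close>
  define blk where "blk i = (i - 1 :: nat) div 7" for i
  have vars: "(\<Union>c\<in>set cs. clause_vars c) = {1..n}"
    using x by (simp add: sat3_instance_def cs_def n_def)
  have sols: "sat3_solutions x = {v \<in> {1..n} \<rightarrow>\<^sub>E UNIV. \<forall>c<k. clause_true v (cs ! c)}"
    by (auto simp: sat3_solutions_def n_def cs_def k_def all_set_conv_all_nth)
  have G: "?G = {S. S \<subseteq> {..<7 * k + 1} \<and> 0 \<in> S \<and> card S = k + 1 \<and>
                  (\<forall>i\<in>S. \<forall>j\<in>S. \<forall>l\<in>L i. \<forall>l'\<in>L j. l \<noteq> neg_lit l')}"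
    by (simp add: conflicts_eq_0_iff k_def cs_def sat3_size_def L_def)
  have L0: "L 0 = {Neg 0}" by (simp add: L_def slots_0)
  have L: "L (Suc (7 * c + a)) = set (clause_slots (cs ! c) ! a)" if "c < k" "a < 7" for c a
    using that slots_Suc[of c cs a] by (simp add: L_def k_def)
  have idx: "blk i < k \<and> (\<exists>a<7. i = Suc (7 * blk i + a))" if "i < 7 * k + 1" "i \<noteq> 0" for i
  proof -
    have "i = Suc (7 * blk i + (i - 1) mod 7)" using that by (simp add: blk_def)
    moreover have "blk i < k" using that by (simp add: blk_def div_less_iff_less_mult)
    ultimately show ?thesis by (metis mod_less_divisor zero_less_numeral)
  qed
  have Lvar: "literal_var l \<in> {1..n}" if i: "i < 7 * k + 1" "i \<noteq> 0" and l: "l \<in> L i" for i l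
  proof -
    obtain c a where ca: "c < k" "a < 7" "i = Suc (7 * c + a)"
      using idx[OF i] by blast
    then have "literal_var l \<in> clause_vars (cs ! c)"
      using l slot_vars[of a "cs ! c"] L by blast
    then show ?thesis using vars ca by (auto simp: k_def)
  qed
  have cvar: "clause_vars (cs ! c) \<subseteq> {1..n}" if "c < k" for c
    using vars that by (auto simp: k_def)
  have clause_ext: "clause_true (ext v) (cs ! c) \<longleftrightarrow> clause_true v (cs ! c)" if "c < k" for v c
  proof -
    have lit: "literal_true (ext v) l \<longleftrightarrow> literal_true v l" if "literal_var l \<in> {1..n}" for l
      using that by (cases l) (auto simp: ext_def)
    show ?thesis using cvar[OF that] by (cases "cs ! c") (auto simp: lit)
  qed
  have blk: "blk (Suc (7 * c + a)) = c" if "a < 7" for c a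
    using that by (simp add: blk_def)
  have F_subset: "F v \<subseteq> {..<7 * k + 1}" and F_0: "0 \<in> F v" for v
    by (auto simp: F_def L0 ext_def)
  \<comment> \<open>Literals that are true under one assignment cannot be complementary.\<close>
  have F_conflict: "l \<noteq> neg_lit l'" if "i \<in> F v" "j \<in> F v" "l \<in> L i" "l' \<in> L j" for v i j l l'
    using that unfolding F_def by fastforce
  have inj: "inj_on blk (S - {0})"
    if S: "S \<subseteq> {..<7 * k + 1}" "\<forall>i\<in>S. \<forall>j\<in>S. \<forall>l\<in>L i. \<forall>l'\<in>L j. l \<noteq> neg_lit l'" for S
  proof (rule inj_onI)
    fix i j assume ij: "i \<in> S - {0}" "j \<in> S - {0}" "blk i = blk j"
    have "i < 7 * k + 1" "i \<noteq> 0" "j < 7 * k + 1" "j \<noteq> 0" using S(1) ij by auto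
    then obtain c a a' where i: "c < k" "a < 7" "i = Suc (7 * c + a)"
      and j: "a' < 7" "j = Suc (7 * c + a')"
      using idx[of i] idx[of j] ij(3) by auto
    have "conflicts (clause_slots (cs ! c) ! a) (clause_slots (cs ! c) ! a') = 0"
      unfolding conflicts_eq_0_iff using S(2) ij(1,2) L[of c a] L[of c a'] i j by blast
    then have "a = a'" using slots_of_clause_conflict i j by blast
    then show "i = j" using i j by simp
  qed
  have F_blk: "\<exists>i\<in>F v - {0}. blk i = c" if "clause_true v (cs ! c)" "c < k" for v c
  proof -
    have "\<exists>a<7. \<forall>l\<in>set (clause_slots (cs ! c) ! a). literal_true (ext v) l"
      using slot_of_satisfied_clause[of "ext v" "cs ! c"] clause_ext that by blast
    then obtain a where "a < 7" "\<forall>l\<in>set (clause_slots (cs ! c) ! a). literal_true (ext v) l"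
      by blast
    then show ?thesis
      using that L blk by (intro bexI[of _ "Suc (7 * c + a)"]) (auto simp: F_def)
  qed
  have F_card: "card (F v) = k + 1" if "v \<in> sat3_solutions x" for v
  proof -
    \<comment> \<open>The slots of \<open>F v\<close> other than 0 correspond bijectively to the
      clauses.\<close>
    have "blk ` (F v - {0}) = {..<k}"
    proof
      show "blk ` (F v - {0}) \<subseteq> {..<k}" using idx F_subset by blast
      show "{..<k} \<subseteq> blk ` (F v - {0})"
        using F_blk[of v] that unfolding sols by blast
    qed
    moreover have "inj_on blk (F v - {0})"
      using F_conflict F_subset by (intro inj) blast+
    ultimately have "card (F v - {0}) = k"
      by (metis card_image card_lessThan)
    then show ?thesis
      using F_0 F_subset finite_subset by (metis Suc_eq_plus1 card.remove finite_lessThan)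
  qed
  have "bij_betw F (sat3_solutions x) ?G"
    unfolding G
  proof (rule bij_betwI')
    fix v assume "v \<in> sat3_solutions x"
    then show "F v \<in> {S. S \<subseteq> {..<7 * k + 1} \<and> 0 \<in> S \<and> card S = k + 1 \<and>
                  (\<forall>i\<in>S. \<forall>j\<in>S. \<forall>l\<in>L i. \<forall>l'\<in>L j. l \<noteq> neg_lit l')}"
      using F_subset F_0 F_card F_conflict by blast
  next
    fix v w assume v: "v \<in> sat3_solutions x" and w: "w \<in> sat3_solutions x"
    have "v = w" if eq: "F v = F w"
    proof
      fix m
      show "v m = w m"
      proof (cases "m \<in> {1..n}")
        case True
        \<comment> \<open>By \<open>sat3_instance\<close>, \<open>m\<close> occurs in some clause.
          Its slot in \<open>F v = F w\<close> contains a literal on \<open>m\<close>, which is true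
          under both assignments.\<close>
        then obtain c where c: "c < k" "m \<in> clause_vars (cs ! c)"
          using vars unfolding k_def by (metis UN_E in_set_conv_nth)
        then obtain i where i: "i \<in> F v - {0}" "blk i = c"
          using F_blk[of v c] v unfolding sols by blast
        then obtain a where a: "a < 7" "i = Suc (7 * c + a)"
          using idx[of i] F_subset by blast
        have "m \<in> literal_var ` L i"
          unfolding a(2) L[OF c(1) a(1)] slot_vars[OF a(1)] by (rule c(2))
        then obtain l where l: "l \<in> L i" "literal_var l = m"
          by blast
        then have "literal_true (ext v) l" "literal_true (ext w) l"
          using i eq by (auto simp: F_def)
        then show ?thesis using l(2) True by (cases l) (auto simp: ext_def)
      next
        case False
        \<comment> \<open>Outside \<open>{1..n}\<close> both assignments have the default value
          \<open>undefined\<close>.\<close>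
        then show ?thesis using v w by (auto simp: sols PiE_def extensional_def)
      qed
    qed
    then show "(F v = F w) = (v = w)" by blast
  next
    fix S assume "S \<in> {S. S \<subseteq> {..<7 * k + 1} \<and> 0 \<in> S \<and> card S = k + 1 \<and>
                  (\<forall>i\<in>S. \<forall>j\<in>S. \<forall>l\<in>L i. \<forall>l'\<in>L j. l \<noteq> neg_lit l')}"
    then have S: "S \<subseteq> {..<7 * k + 1}" "0 \<in> S" "card S = k + 1"
      and free: "\<forall>i\<in>S. \<forall>j\<in>S. \<forall>l\<in>L i. \<forall>l'\<in>L j. l \<noteq> neg_lit l'"
      by auto
    \<comment> \<open>A variable is true if it occurs positively in a slot of \<open>S\<close>;
      \<open>restrict\<close> supplies the value \<open>undefined\<close> demanded outside
      \<open>{1..n}\<close>.\<close>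
    define v where "v = restrict (\<lambda>m. \<exists>i\<in>S. Pos m \<in> L i) {1..n}"
    have "S \<subseteq> F v"
    proof
      fix i assume i: "i \<in> S"
      have "literal_true (ext v) l" if l: "l \<in> L i" for l
      proof (cases l)
        case (Pos m)
        then have "i \<noteq> 0" using l L0 by (intro notI) simp
        then have "m \<in> {1..n}" using Lvar[of i l] i l S Pos by auto
        then show ?thesis using Pos i l by (auto simp: v_def ext_def)
      next
        case (Neg m)
        \<comment> \<open>If \<open>m\<close> were true, some slot of \<open>S\<close> would contain
          \<open>Pos m\<close> and conflict with slot \<open>i\<close>.\<close>
        have False if "ext v m"
        proof -
          have "m \<noteq> 0" using that by (auto simp: ext_def split: if_splits)
          then have "i \<noteq> 0" using l L0 Neg by (intro notI) simp
          then have "m \<in> {1..n}" using Lvar[of i l] i l S Neg by auto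
          then obtain j where "j \<in> S" "Pos m \<in> L j"
            using \<open>ext v m\<close> \<open>m \<noteq> 0\<close> by (auto simp: v_def ext_def)
          then show False using free i l Neg by force
        qed
        then show ?thesis using Neg by auto
      qed
      then show "i \<in> F v" using i S by (auto simp: F_def)
    qed
    have fin: "finite S" using S finite_subset by blast
    \<comment> \<open>Without coordinate 0, \<open>S\<close> has \<open>k\<close> slots in pairwise
      different clauses, so every clause is met.\<close>
    have "card (blk ` (S - {0})) = k"
      using inj[OF S(1) free] S fin by (simp add: card_image)
    moreover have "blk ` (S - {0}) \<subseteq> {..<k}" using idx S(1) by blast
    ultimately have blk_S: "blk ` (S - {0}) = {..<k}"
      by (metis card_lessThan card_subset_eq finite_lessThan)
    have "clause_true v (cs ! c)" if c: "c < k" for c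
    proof -
      have "c \<in> blk ` (S - {0})" using c blk_S by simp
      then obtain i where i: "i \<in> S - {0}" "blk i = c" by blast
      then obtain a where a: "a < 7" "i = Suc (7 * c + a)"
        using idx[of i] S(1) by blast
      then have "\<forall>l\<in>set (clause_slots (cs ! c) ! a). literal_true (ext v) l"
        using \<open>S \<subseteq> F v\<close> i(1) L[OF c a(1)] by (auto simp: F_def)
      then show ?thesis using clause_true_of_slot[OF a(1)] clause_ext[OF c] by blast
    qed
    then have v: "v \<in> sat3_solutions x" by (simp add: sols v_def)
    have "finite (F v)" using F_subset finite_subset by blast
    \<comment> \<open>Both sets have \<open>k + 1\<close> elements, so the inclusion is an
      equality.\<close>
    then have "S = F v"
      using \<open>S \<subseteq> F v\<close> F_card[OF v] S(3) by (intro card_subset_eq) auto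
    then show "\<exists>v\<in>sat3_solutions x. S = F v" using v by blast
  qed
  then show ?thesis by (rule bij_betw_same_card[symmetric])
qed

text \<open>Row \<open>i \<noteq> 0\<close> of the condition says that \<open>0 \<in> S\<close> (by parity) and that \<open>i\<close> conflicts with no
  element of \<open>S\<close>; row \<open>0\<close> then counts the elements of \<open>S\<close>.\<close>

lemma weighted_sets_iff:
  fixes w :: "nat \<Rightarrow> nat \<Rightarrow> nat"
  assumes "finite S" and w0: "\<And>i. i \<in> S \<Longrightarrow> w i 0 = 0" "\<And>j. j \<in> S \<Longrightarrow> w 0 j = 0"
  shows "S \<noteq> {} \<and> (\<forall>i\<in>S. (\<Sum>j\<in>S. D * of_bool (i = j) + (of_bool (i = 0) + of_bool (j = 0) + 2 * w i j)) =
             D + 1 + of_bool (i = 0) * (k + 1)) \<longleftrightarrow>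
         0 \<in> S \<and> card S = k + 1 \<and> (\<forall>i\<in>S. \<forall>j\<in>S. w i j = 0)"
proof -
  have sum: "(\<Sum>j\<in>S. D * of_bool (i = j) + (of_bool (i = 0) + of_bool (j = 0) + 2 * w i j)) =
        D + (of_bool (i = 0) * card S + of_bool (0 \<in> S) + 2 * (\<Sum>j\<in>S. w i j))" if "i \<in> S" for i
  proof -
    have "(\<Sum>j\<in>S. D * of_bool (i = j)) = (\<Sum>j\<in>S. if i = j then D else 0)"
      by (intro sum.cong) auto
    also have "\<dots> = D" using assms(1) that by simp
    finally have "(\<Sum>j\<in>S. D * of_bool (i = j)) = D" .
    moreover have "(\<Sum>j\<in>S. of_bool (j = 0)) = (\<Sum>j\<in>S. if j = 0 then 1 else 0 :: nat)"
      by (intro sum.cong) auto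
    ultimately show ?thesis
      using assms(1) by (simp add: sum.distrib sum_distrib_left)
  qed
  have row: "(\<Sum>j\<in>S. D * of_bool (i = j) + (of_bool (i = 0) + of_bool (j = 0) + 2 * w i j)) =
             D + 1 + of_bool (i = 0) * (k + 1) \<longleftrightarrow>
        0 \<in> S \<and> (\<forall>j\<in>S. w i j = 0) \<and> (i = 0 \<longrightarrow> card S = k + 1)" if i: "i \<in> S" for i
  proof (cases "i = 0")
    case True
    \<comment> \<open>As \<open>0 \<in> S\<close>, this row sums to \<open>D + card S + 1\<close>,
      to be matched with \<open>D + 1 + (k + 1)\<close>; its conflict terms vanish by
      \<open>w0\<close>.\<close>
    then show ?thesis unfolding sum[OF i] using i w0 by auto
  next
    case False
    have "of_bool (0 \<in> S) + 2 * (\<Sum>j\<in>S. w i j) = 1 \<longleftrightarrow> 0 \<in> S \<and> (\<Sum>j\<in>S. w i j) = 0"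
      by (cases "0 \<in> S") simp_all
    then show ?thesis unfolding sum[OF i] using False assms(1) by simp
  qed
  then have "(\<forall>i\<in>S. (\<Sum>j\<in>S. D * of_bool (i = j) + (of_bool (i = 0) + of_bool (j = 0) + 2 * w i j)) =
             D + 1 + of_bool (i = 0) * (k + 1)) \<longleftrightarrow>
        (\<forall>i\<in>S. 0 \<in> S \<and> (\<forall>j\<in>S. w i j = 0) \<and> (i = 0 \<longrightarrow> card S = k + 1))"
    by (intro ball_cong refl)
  \<comment> \<open>Non-emptiness provides some row, that row gives \<open>0 \<in> S\<close>, and
    row 0 then gives the cardinality.\<close>
  then show ?thesis by blast
qed

section \<open>The reduction\<close>

text \<open>The entries added to the diagonal matrix for \<open>e = 2\<close> are at most \<open>20\<close>, so any factor above \<open>20\<close>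
  in place of \<open>32\<close> gives diagonal dominance; a power of two is computed by doubling.\<close>

definition entry :: "clause list \<Rightarrow> nat \<Rightarrow> nat \<Rightarrow> nat \<Rightarrow> nat" where
  "entry cs e i j =
     (if e = 1 then of_bool (i = j)
      else 32 * (7 * length cs + 1) * of_bool (i = j) +
           (of_bool (i = 0) + of_bool (j = 0) + 2 * conflicts (slots cs ! i) (slots cs ! j)))"

text \<open>For \<open>e = 2\<close>, a slot in a solution receives the diagonal term and a 1 from
  coordinate 0; coordinate 0 receives in addition one unit from each of the \<open>k + 1\<close>
  elements.\<close>

definition target :: "clause list \<Rightarrow> nat \<Rightarrow> nat \<Rightarrow> nat" where
  "target cs e i =
     (if e = 1 then 1 else 32 * (7 * length cs + 1) + 1 + of_bool (i = 0) * (length cs + 1))"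

definition reduction :: "sat3 \<Rightarrow> exist_lis" where
  "reduction x = lis_of_nats (7 * length (clauses x) + 1) (entry (clauses x)) (target (clauses x))"

lemma length_slot:
  assumes "i < 7 * length cs + 1"
  shows "length (slots cs ! i) = 3"
proof -
  have "slots cs ! i \<in> set (slots cs)" using assms by (simp add: length_slots)
  then show ?thesis by (auto simp: slots_def)
qed

lemma conflicts_le:
  assumes "length s = 3" "length t = 3"
  shows "conflicts s t \<le> 9"
  using assms by (auto simp: conflicts_def numeral_3_eq_3 length_Suc_conv)

lemma reduction_instance: "exist_lis_instance (reduction x)"
proof -
  define cs where "cs = clauses x"
  define d where "d = 7 * length cs + 1"
  \<comment> \<open>The identity is the dominant diagonal \<open>D = 1\<close> with
    \<open>A = 0\<close> and \<open>c = 0\<close>.\<close>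
  have 1: "positive_definite d (mat d d (\<lambda>(i, j). real (entry cs 1 i j)))"
    using positive_definite_diag_dominant[of d "\<lambda>_ _. 0" 0 1] by (simp add: entry_def)
  have 2: "positive_definite d (mat d d (\<lambda>(i, j). real (entry cs 2 i j)))"
    unfolding entry_def d_def[symmetric]
  proof -
    have "of_bool (i = 0) + of_bool (j = 0) + 2 * conflicts (slots cs ! i) (slots cs ! j) \<le> (20 :: nat)"
      if "i < d" "j < d" for i j
    proof -
      have "conflicts (slots cs ! i) (slots cs ! j) \<le> 9"
        using that by (intro conflicts_le length_slot) (simp_all add: d_def)
      moreover have "of_bool (i = 0) \<le> (1 :: nat)" "of_bool (j = 0) \<le> (1 :: nat)" by simp_all
      ultimately show ?thesis by linarith
    qed
    then show "positive_definite d (mat d d (\<lambda>(i, j). real (if (2 :: nat) = 1 then of_bool (i = j)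
      else 32 * d * of_bool (i = j) +
           (of_bool (i = 0) + of_bool (j = 0) + 2 * conflicts (slots cs ! i) (slots cs ! j)))))"
      using positive_definite_diag_dominant[of d "\<lambda>i j. of_bool (i = 0) + of_bool (j = 0) +
        2 * conflicts (slots cs ! i) (slots cs ! j)" 20 "32 * d"]
      by (simp add: conflicts_commute d_def)
  qed
  show ?thesis
    using 1 2 by (auto simp: exist_lis_instance_def reduction_def lis_of_nats_def cs_def d_def)
qed

lemma card_lis_solutions_reduction:
  assumes "sat3_instance x"
  shows "card (lis_solutions (reduction x)) = card (sat3_solutions x)"
proof -
  define cs where "cs = clauses x"
  define k where "k = length cs"
  define w where "w i j = conflicts (slots cs ! i) (slots cs ! j)" for i j
  \<comment> \<open>Variables of a formula start at 1, so no clause slot contains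
    \<open>Pos 0\<close>, the complement of the literal in slot 0.\<close>
  have vars: "literal_var l \<noteq> 0" if l: "l \<in> set (slots cs ! i)" and i: "i < 7 * k + 1" "i \<noteq> 0" for i l
  proof -
    have "slots cs ! i \<in> set (concat (map clause_slots cs))"
      using i length_slots[of cs] nth_mem[of "i - 1" "concat (map clause_slots cs)"]
      by (simp add: slots_def k_def nth_Cons')
    then obtain c s where c: "c \<in> set cs" "s \<in> set (clause_slots c)" "s = slots cs ! i"
      by auto
    then obtain a where a: "a < 7" "s = clause_slots c ! a"
      using in_set_conv_nth[of s "clause_slots c"] by auto
    have "literal_var l \<in> literal_var ` set (clause_slots c ! a)"
      using l c(3) a(2) by simp
    then have "literal_var l \<in> clause_vars c"
      by (simp only: slot_vars[OF a(1)])
    then have "literal_var l \<in> {1..num_vars x}"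
      using assms c(1) unfolding sat3_instance_def cs_def by blast
    then show ?thesis by simp
  qed
  have w0: "w 0 i = 0" if "i < 7 * k + 1" for i
  proof (cases "i = 0")
    case False
    show ?thesis
      unfolding w_def conflicts_eq_0_iff
    proof (intro ballI notI)
      fix l l' assume l: "l \<in> set (slots cs ! 0)" "l' \<in> set (slots cs ! i)" "l = neg_lit l'"
      have "literal_var l = 0" using l(1) by (auto simp: slots_0)
      then show False using l vars[OF l(2) that False] by simp
    qed
  qed (simp add: w_def conflicts_eq_0_iff slots_0)
  have "lis_solutions (reduction x) =
     {S. S \<subseteq> {..<7 * k + 1} \<and> S \<noteq> {} \<and> (\<forall>i\<in>S. (\<Sum>j\<in>S. entry cs 2 i j) = target cs 2 i)}"
    unfolding reduction_def k_def cs_def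
    using reduction_instance[of x] by (intro lis_solutions_identity) (simp_all add: reduction_def entry_def target_def)
  also have "\<dots> = {S. S \<subseteq> {..<7 * k + 1} \<and> 0 \<in> S \<and> card S = k + 1 \<and> (\<forall>i\<in>S. \<forall>j\<in>S. w i j = 0)}"
  proof (rule Collect_cong, rule conj_cong, rule refl)
    fix S assume S: "S \<subseteq> {..<7 * k + 1}"
    have eq: "entry cs 2 i j = 32 * (7 * k + 1) * of_bool (i = j) + (of_bool (i = 0) + of_bool (j = 0) + 2 * w i j)"
      "target cs 2 i = 32 * (7 * k + 1) + 1 + of_bool (i = 0) * (k + 1)" for i j
      by (simp_all add: entry_def target_def k_def w_def)
    have "finite S" using S finite_subset by blast
    moreover have 0: "w 0 i = 0" if "i \<in> S" for i
      using w0[of i] S that by auto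
    moreover have "w i 0 = 0" if "i \<in> S" for i
      using 0[OF that] unfolding w_def by (subst conflicts_commute)
    ultimately show "(S \<noteq> {} \<and> (\<forall>i\<in>S. (\<Sum>j\<in>S. entry cs 2 i j) = target cs 2 i)) =
        (0 \<in> S \<and> card S = k + 1 \<and> (\<forall>i\<in>S. \<forall>j\<in>S. w i j = 0))"
      unfolding eq by (intro weighted_sets_iff)
  qed
  finally show ?thesis
    using card_no_conflicts_sets[OF assms] by (simp add: k_def cs_def sat3_size_def w_def)
qed

section \<open>Output codes\<close>

lemma is_real_code_of_nat: "is_real_code (real n) [0, n, 1]"
proof -
  have "quotient_of (of_nat n) = (int n, 1)"
    using quotient_of_int[of "int n"] by (simp add: Rat.of_int_def)
  then show ?thesis
    unfolding is_real_code_def by (intro exI[of _ "of_nat n"]) (simp add: rat_code_def)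
qed

text \<open>The number of rows is a separate parameter so that loop invariants can describe the
  output after the first \<open>n\<close> rows.\<close>

definition matrix_codes :: "nat \<Rightarrow> nat \<Rightarrow> (nat \<Rightarrow> nat \<Rightarrow> nat) \<Rightarrow> nat list list" where
  "matrix_codes n d f = concat (map (\<lambda>i. map (\<lambda>j. [0, f i j, 1]) [0..<d]) [0..<n])"

definition vector_codes :: "nat \<Rightarrow> (nat \<Rightarrow> nat) \<Rightarrow> nat list list" where
  "vector_codes n f = map (\<lambda>i. [0, f i, 1]) [0..<n]"

lemma is_lis_code_of_nats:
  "is_lis_code (lis_of_nats d a b)
     (d # concat (matrix_codes d d (a 1) @ vector_codes d (b 1) @ matrix_codes d d (a 2) @ vector_codes d (b 2)))"
proof -
  define y where "y = lis_of_nats d a b"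
  have "lis_entries y e = concat (map (\<lambda>i. map (\<lambda>j. real (a e i j)) [0..<d]) [0..<d]) @ map (\<lambda>i. real (b e i)) [0..<d]" for e
    unfolding lis_entries_def
    by (auto simp: y_def lis_of_nats_def intro!: arg_cong[where f = concat] map_cong)
  moreover have row: "list_all2 is_real_code (map (\<lambda>i. real (f i)) [0..<d]) (vector_codes d f)" for f
    unfolding vector_codes_def list_all2_map1 list_all2_map2
    by (rule list_all2_refl) (rule is_real_code_of_nat)
  moreover have "list_all2 is_real_code (concat (map (\<lambda>i. map (\<lambda>j. real (f i j)) [0..<d]) [0..<n]))
      (matrix_codes n d f)" for f n
    using row by (induction n) (simp_all add: matrix_codes_def vector_codes_def list_all2_appendI)
  ultimately have "list_all2 is_real_code (lis_entries y e) (matrix_codes d d (a e) @ vector_codes d (b e))" for e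
    by (simp add: list_all2_appendI)
  then have "list_all2 is_real_code (lis_entries y 1 @ lis_entries y 2)
     ((matrix_codes d d (a 1) @ vector_codes d (b 1)) @ (matrix_codes d d (a 2) @ vector_codes d (b 2)))"
    by (intro list_all2_appendI)
  then show ?thesis
    unfolding is_lis_code_def y_def[symmetric]
    by (intro exI conjI) (auto simp: y_def lis_of_nats_def)
qed

section \<open>Time-bounded Hoare logic\<close>

text \<open>Jumps are absolute, so a piece of code is a function of the address at which it is placed.\<close>

type_synonym code = "nat \<Rightarrow> instr list"
type_synonym assn = "(nat \<Rightarrow> nat) \<Rightarrow> nat list \<Rightarrow> nat list \<Rightarrow> bool"

definition holds :: "assn \<Rightarrow> config \<Rightarrow> bool" where
  "holds Q s \<longleftrightarrow> Q (cfg_mem s) (cfg_in s) (cfg_out s)"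

text \<open>Total correctness with a time bound. Quantifying over \<open>pre\<close> and
  \<open>post\<close> lets the code sit anywhere in a program; control leaves it at the address just
  behind it.\<close>

definition hoare :: "assn \<Rightarrow> code \<Rightarrow> nat \<Rightarrow> assn \<Rightarrow> bool" where
  "hoare Q c t R \<longleftrightarrow>
     (\<forall>pre post s. cfg_pc s = length pre \<and> holds Q s \<longrightarrow>
        (\<exists>n s'. n \<le> t \<and> (step (pre @ c (length pre) @ post) ^^ n) s = s' \<and>
           cfg_pc s' = length pre + length (c (length pre)) \<and> holds R s'))"

definition seqc :: "code \<Rightarrow> code \<Rightarrow> code" where
  "seqc c1 c2 = (\<lambda>l. c1 l @ c2 (l + length (c1 l)))"

text \<open>A while loop on \<open>m[r] \<noteq> 0\<close>: the test is at \<open>l\<close>, the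
  body starts at \<open>l + 1\<close>, and the exit address lies just behind the jump back.\<close>

definition loopc :: "nat \<Rightarrow> code \<Rightarrow> code" where
  "loopc r c = (\<lambda>l. JumpZero r (l + length (c (l + 1)) + 2) # c (l + 1) @ [Jump l])"

definition block :: "instr list \<Rightarrow> code" where
  "block is = (\<lambda>_. is)"

fun is_jump :: "instr \<Rightarrow> bool" where
  "is_jump (Jump _) = True"
| "is_jump (JumpZero _ _) = True"
| "is_jump _ = False"

section \<open>Proof rules\<close>

lemma hoare_conseq:
  assumes "hoare Q c t R" "\<And>m i o'. Q' m i o' \<Longrightarrow> Q m i o'" "\<And>m i o'. R m i o' \<Longrightarrow> R' m i o'" "t \<le> t'"
  shows "hoare Q' c t' R'"
  using assms unfolding hoare_def holds_def by (meson order_trans)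

lemma hoare_seq:
  assumes "hoare Q c1 t1 R" "hoare R c2 t2 S"
  shows "hoare Q (seqc c1 c2) (t1 + t2) S"
  unfolding hoare_def
proof (intro allI impI, elim conjE)
  fix pre post :: "instr list" and s
  assume s: "cfg_pc s = length pre" "holds Q s"
  let ?a = "c1 (length pre)"
  let ?b = "c2 (length pre + length ?a)"
  obtain n1 s1 where 1: "n1 \<le> t1" "(step (pre @ ?a @ ?b @ post) ^^ n1) s = s1"
      "cfg_pc s1 = length pre + length ?a" "holds R s1"
    using assms(1) s unfolding hoare_def by blast
  \<comment> \<open>The second triple is applied with the first piece of code moved into the
    prefix.\<close>
  have "\<exists>n s'. n \<le> t2 \<and> (step ((pre @ ?a) @ c2 (length (pre @ ?a)) @ post) ^^ n) s1 = s' \<and>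
      cfg_pc s' = length (pre @ ?a) + length (c2 (length (pre @ ?a))) \<and> holds S s'"
    using assms(2) 1 unfolding hoare_def by (metis length_append)
  then obtain n2 s2 where 2: "n2 \<le> t2" "(step (pre @ ?a @ ?b @ post) ^^ n2) s1 = s2"
      "cfg_pc s2 = length pre + length ?a + length ?b" "holds S s2"
    by auto
  have "(step (pre @ ?a @ ?b @ post) ^^ (n2 + n1)) s = s2"
    using 1 2 by (simp add: funpow_add)
  then show "\<exists>n s'. n \<le> t1 + t2 \<and> (step (pre @ seqc c1 c2 (length pre) @ post) ^^ n) s = s' \<and>
      cfg_pc s' = length pre + length (seqc c1 c2 (length pre)) \<and> holds S s'"
    using 1 2 by (intro exI[of _ "n2 + n1"]) (auto simp: seqc_def)
qed

lemma exec_pc: "\<not> is_jump a \<Longrightarrow> cfg_pc (exec a s) = cfg_pc s + 1"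
  by (cases a) auto

text \<open>Without jumps the program counter only advances, so the effect of a block is a fold that
  simplification can evaluate.\<close>

lemma steps_block:
  assumes "\<forall>a\<in>set is. \<not> is_jump a" "cfg_pc s = length pre"
  shows "(step (pre @ is @ post) ^^ length is) s = fold exec is s \<and>
         cfg_pc (fold exec is s) = length pre + length is"
  using assms
proof (induction "is" arbitrary: pre s)
  case (Cons a "is")
  have 1: "step (pre @ (a # is) @ post) s = exec a s"
    using Cons.prems by (simp add: step_def halted_def)
  have "cfg_pc (exec a s) = length (pre @ [a])"
    using Cons.prems exec_pc by simp
  then have "(step ((pre @ [a]) @ is @ post) ^^ length is) (exec a s) = fold exec is (exec a s) \<and>
         cfg_pc (fold exec is (exec a s)) = length (pre @ [a]) + length is"
    using Cons.prems by (intro Cons.IH) auto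
  then show ?case using 1 by (simp add: funpow_swap1)
qed simp

lemma hoare_block:
  assumes "\<forall>a\<in>set is. \<not> is_jump a" "\<And>s. holds Q s \<Longrightarrow> holds R (fold exec is s)" "length is \<le> t"
  shows "hoare Q (block is) t R"
  using steps_block[OF assms(1)] assms(2,3) unfolding hoare_def block_def by blast

text \<open>Register \<open>r\<close> counts the remaining rounds. Each round costs the body, a test
  and a jump back; the final 1 is the failing test.\<close>

lemma hoare_loop:
  assumes body: "\<And>j. j < n \<Longrightarrow> hoare (\<lambda>m i o'. Inv j m i o' \<and> m r = n - j) c t
                                     (\<lambda>m i o'. Inv (Suc j) m i o' \<and> m r = n - Suc j)"
  shows "hoare (\<lambda>m i o'. Inv 0 m i o' \<and> m r = n) (loopc r c) (n * (t + 2) + 1) (Inv n)"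
  unfolding hoare_def
proof (intro allI impI, elim conjE)
  fix pre post :: "instr list" and s
  assume s: "cfg_pc s = length pre" "holds (\<lambda>m i o'. Inv 0 m i o' \<and> m r = n) s"
  define P where "P = pre @ loopc r c (length pre) @ post"
  let ?b = "c (length pre + 1)"
  let ?test = "JumpZero r (length pre + length ?b + 2)"
  have P1: "P = pre @ ?test # ?b @ Jump (length pre) # post"
    by (simp add: P_def loopc_def)
  have P2: "P = (pre @ [?test]) @ c (length (pre @ [?test])) @ Jump (length pre) # post"
    by (simp add: P1)
  have nth_jump: "P ! (length pre + 1 + length ?b) = Jump (length pre)"
    unfolding P1 by (simp add: nth_append)
  have step_jump: "step P u = u\<lparr>cfg_pc := length pre\<rparr>" if "cfg_pc u = length pre + 1 + length ?b" for u
    using that nth_jump by (simp add: step_def halted_def P1)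
  have step_test: "step P u = u\<lparr>cfg_pc := if cfg_mem u r = 0 then length pre + length ?b + 2
                                         else length pre + 1\<rparr>" if "cfg_pc u = length pre" for u
    using that by (simp add: step_def halted_def P1)
  \<comment> \<open>After \<open>j\<close> rounds the machine stands at the loop test.\<close>
  have *: "\<exists>k u. k \<le> j * (t + 2) \<and> (step P ^^ k) s = u \<and> cfg_pc u = length pre \<and>
             Inv j (cfg_mem u) (cfg_in u) (cfg_out u) \<and> cfg_mem u r = n - j" if "j \<le> n" for j
    using that
  proof (induction j)
    case 0
    then show ?case using s by (auto simp: holds_def)
  next
    case (Suc j)
    then obtain k u where u: "k \<le> j * (t + 2)" "(step P ^^ k) s = u" "cfg_pc u = length pre"
        "Inv j (cfg_mem u) (cfg_in u) (cfg_out u)" "cfg_mem u r = n - j"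
      by auto
    define v where "v = step P u"
    have v: "v = u\<lparr>cfg_pc := length pre + 1\<rparr>"
      using step_test[OF u(3)] u(5) Suc.prems by (simp add: v_def)
    have "\<exists>l w. l \<le> t \<and> (step P ^^ l) v = w \<and>
        cfg_pc w = length (pre @ [?test]) + length (c (length (pre @ [?test]))) \<and>
        holds (\<lambda>m i o'. Inv (Suc j) m i o' \<and> m r = n - Suc j) w"
      using body[of j, unfolded hoare_def, rule_format, of v "pre @ [?test]" "Jump (length pre) # post"]
        Suc.prems u v unfolding P2 by (simp add: holds_def)
    then obtain l w where w: "l \<le> t" "(step P ^^ l) v = w" "cfg_pc w = length pre + 1 + length ?b"
        "Inv (Suc j) (cfg_mem w) (cfg_in w) (cfg_out w)" "cfg_mem w r = n - Suc j"
      by (auto simp: holds_def)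
    have "(step P ^^ (1 + l + 1 + k)) s = step P w"
      unfolding funpow_add using u w v_def by (simp add: o_def)
    then show ?case
      using u w step_jump[OF w(3)] by (intro exI[of _ "1 + l + 1 + k"]) auto
  qed
  obtain k u where u: "k \<le> n * (t + 2)" "(step P ^^ k) s = u" "cfg_pc u = length pre"
      "Inv n (cfg_mem u) (cfg_in u) (cfg_out u)" "cfg_mem u r = 0"
    using *[of n] by auto
  have "(step P ^^ (1 + k)) s = u\<lparr>cfg_pc := length pre + length ?b + 2\<rparr>"
    using u step_test[OF u(3)] by simp
  then show "\<exists>k s'. k \<le> n * (t + 2) + 1 \<and> (step (pre @ loopc r c (length pre) @ post) ^^ k) s = s' \<and>
      cfg_pc s' = length pre + length (loopc r c (length pre)) \<and> holds (Inv n) s'"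
    using u unfolding P_def[symmetric]
    by (intro exI[of _ "1 + k"]) (auto simp: holds_def loopc_def)
qed

lemma hoare_computes:
  assumes "hoare (\<lambda>m i o'. m = (\<lambda>_. 0) \<and> i = ws \<and> o' = []) c t (\<lambda>m i o'. o' = out)" "t \<le> t'"
  shows "computes_within (c 0) ws t' out"
proof -
  have "\<exists>n s'. n \<le> t \<and> (step ([] @ c (length []) @ []) ^^ n) (initial_config ws) = s' \<and>
      cfg_pc s' = length ([] :: instr list) + length (c (length ([] :: instr list))) \<and>
      holds (\<lambda>m i o'. o' = out) s'"
    using assms(1)[unfolded hoare_def, rule_format, of "initial_config ws" "[]" "[]"]
    by (simp add: holds_def initial_config_def)
  then obtain n s' where s': "n \<le> t" "(step (c 0) ^^ n) (initial_config ws) = s'"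
      "halted (c 0) s'" "cfg_out s' = out"
    by (auto simp: holds_def halted_def)
  \<comment> \<open>A halted machine no longer changes, so any larger time bound works too.\<close>
  have "(step (c 0) ^^ j) s' = s'" for j
    using s'(3) by (induction j) (auto simp: step_def)
  then have "(step (c 0) ^^ (t' - n + n)) (initial_config ws) = s'"
    using s'(2) by (simp add: funpow_add)
  then show ?thesis
    using s' assms(2) by (simp add: computes_within_def)
qed

section \<open>The program\<close>

text \<open>With \<open>k\<close> clauses and \<open>d = 7 k + 1\<close>, the registers hold
  \<^item> 0 and 2: the constants \<open>0\<close> and \<open>1\<close>; 1: the diagonal term \<open>32 d\<close>; 3: \<open>d\<close>; 4: \<open>k\<close>;
  \<^item> 5 and 6: loop counters; 7 and 8: row and column index; 9 and 10: pointers into the table;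
  \<^item> 11: the value to be written; 12 and 13: scratch;
  \<^item> 14 and 15: first the literal being read, later the two values of \<open>u\<close> for \<open>e = 2\<close>;
  \<^item> 20 to 25 and 26 to 31: the table entries of two slots.

  The table starts at address 32 and contains, for each of the three literals of a slot, the word of
  the literal and that of its negation, so that a conflict is an equality of words.\<close>

definition store_list :: "nat list \<Rightarrow> instr list" where
  "store_list rs = concat (map (\<lambda>r. [Store 9 r, Add 9 9 2]) rs)"

definition load_list :: "nat \<Rightarrow> nat list \<Rightarrow> instr list" where
  "load_list p rs = concat (map (\<lambda>r. [Load r p, Add p p 2]) rs)"

text \<open>With truncated subtraction, \<open>1 - ((x - y) + (y - x))\<close> is \<open>1\<close> if \<open>x = y\<close> and \<open>0\<close> otherwise.\<close>

definition count_eqs :: "(nat \<times> nat) list \<Rightarrow> instr list" where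
  "count_eqs ps =
     concat (map (\<lambda>(a, b). [Sub 12 a b, Sub 13 b a, Add 12 12 13, Sub 12 2 12, Add 11 11 12]) ps)"

section \<open>Correctness of the straight-line macros\<close>

lemma not_jump_macros:
  "\<forall>a\<in>set (store_list rs). \<not> is_jump a"
  "\<forall>a\<in>set (load_list p rs). \<not> is_jump a"
  "\<forall>a\<in>set (count_eqs ps). \<not> is_jump a"
  by (auto simp: store_list_def load_list_def count_eqs_def)

lemma length_macros:
  "length (store_list rs) = 2 * length rs"
  "length (load_list p rs) = 2 * length rs"
  "length (count_eqs ps) = 5 * length ps"
  by (induction rs, auto simp: store_list_def load_list_def)
     (induction ps, auto simp: count_eqs_def)

text \<open>The pointer is at least 32 and the sources are registers below 32, so no store destroys
  a value still to be stored.\<close>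

lemma store_list_correct:
  assumes "cfg_mem s 2 = 1" "cfg_mem s 9 \<ge> 32" "set rs \<subseteq> {..<32} - {9}"
  shows "cfg_in (fold exec (store_list rs) s) = cfg_in s \<and>
    cfg_out (fold exec (store_list rs) s) = cfg_out s \<and>
    cfg_mem (fold exec (store_list rs) s) 9 = cfg_mem s 9 + length rs \<and>
    (\<forall>j<length rs. cfg_mem (fold exec (store_list rs) s) (cfg_mem s 9 + j) = cfg_mem s (rs ! j)) \<and>
    (\<forall>a<cfg_mem s 9. a \<noteq> 9 \<longrightarrow> cfg_mem (fold exec (store_list rs) s) a = cfg_mem s a)"
  using assms
proof (induction rs arbitrary: s)
  case (Cons r rs)
  define s1 where "s1 = exec (Add 9 9 2) (exec (Store 9 r) s)"
  have eq: "fold exec (store_list (r # rs)) s = fold exec (store_list rs) s1"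
    by (simp add: store_list_def s1_def)
  have h: "cfg_mem s1 2 = 1" "cfg_mem s1 9 = Suc (cfg_mem s 9)" "cfg_mem s1 (cfg_mem s 9) = cfg_mem s r"
    "\<And>a. a \<noteq> 9 \<Longrightarrow> a \<noteq> cfg_mem s 9 \<Longrightarrow> cfg_mem s1 a = cfg_mem s a" "cfg_in s1 = cfg_in s" "cfg_out s1 = cfg_out s"
    using Cons.prems by (auto simp: s1_def)
  have IH: "cfg_in (fold exec (store_list rs) s1) = cfg_in s1 \<and>
    cfg_out (fold exec (store_list rs) s1) = cfg_out s1 \<and>
    cfg_mem (fold exec (store_list rs) s1) 9 = cfg_mem s1 9 + length rs \<and>
    (\<forall>j<length rs. cfg_mem (fold exec (store_list rs) s1) (cfg_mem s1 9 + j) = cfg_mem s1 (rs ! j)) \<and>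
    (\<forall>a<cfg_mem s1 9. a \<noteq> 9 \<longrightarrow> cfg_mem (fold exec (store_list rs) s1) a = cfg_mem s1 a)"
    using Cons.prems h by (intro Cons.IH) auto
  have nth: "cfg_mem s1 (rs ! j) = cfg_mem s (rs ! j)" if "j < length rs" for j
  proof -
    have "rs ! j \<in> {..<32} - {9}" using Cons.prems(3) that nth_mem by fastforce
    then show ?thesis using Cons.prems(2) by (intro h) auto
  qed
  have "cfg_mem (fold exec (store_list rs) s1) (cfg_mem s 9 + j) = cfg_mem s ((r # rs) ! j)"
    if "j < length (r # rs)" for j
    using that IH h nth Cons.prems(2) by (cases j) auto
  moreover have "cfg_mem (fold exec (store_list rs) s1) a = cfg_mem s a"
    if "a < cfg_mem s 9" "a \<noteq> 9" for a
    using that IH h by auto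
  ultimately show ?case
    unfolding eq using IH h by simp
qed (simp add: store_list_def)

text \<open>Sources are at addresses from 32 on and targets are distinct registers below 32, so
  loads do not interfere; the pointer and the constant 1 are not targets.\<close>

lemma load_list_correct:
  assumes "cfg_mem s 2 = 1" "cfg_mem s p \<ge> 32" "set rs \<subseteq> {..<32} - {2, p}" "distinct rs" "p < 32" "p \<noteq> 2"
  shows "cfg_in (fold exec (load_list p rs) s) = cfg_in s \<and>
    cfg_out (fold exec (load_list p rs) s) = cfg_out s \<and>
    cfg_mem (fold exec (load_list p rs) s) p = cfg_mem s p + length rs \<and>
    (\<forall>j<length rs. cfg_mem (fold exec (load_list p rs) s) (rs ! j) = cfg_mem s (cfg_mem s p + j)) \<and>
    (\<forall>a. a \<notin> insert p (set rs) \<longrightarrow> cfg_mem (fold exec (load_list p rs) s) a = cfg_mem s a)"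
  using assms
proof (induction rs arbitrary: s)
  case (Cons r rs)
  define s1 where "s1 = exec (Add p p 2) (exec (Load r p) s)"
  have eq: "fold exec (load_list p (r # rs)) s = fold exec (load_list p rs) s1"
    by (simp add: load_list_def s1_def)
  have h: "cfg_mem s1 2 = 1" "cfg_mem s1 p = Suc (cfg_mem s p)" "cfg_mem s1 r = cfg_mem s (cfg_mem s p)"
    "\<And>a. a \<noteq> p \<Longrightarrow> a \<noteq> r \<Longrightarrow> cfg_mem s1 a = cfg_mem s a" "cfg_in s1 = cfg_in s" "cfg_out s1 = cfg_out s"
    using Cons.prems by (auto simp: s1_def)
  have IH: "cfg_in (fold exec (load_list p rs) s1) = cfg_in s1 \<and>
    cfg_out (fold exec (load_list p rs) s1) = cfg_out s1 \<and>
    cfg_mem (fold exec (load_list p rs) s1) p = cfg_mem s1 p + length rs \<and>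
    (\<forall>j<length rs. cfg_mem (fold exec (load_list p rs) s1) (rs ! j) = cfg_mem s1 (cfg_mem s1 p + j)) \<and>
    (\<forall>a. a \<notin> insert p (set rs) \<longrightarrow> cfg_mem (fold exec (load_list p rs) s1) a = cfg_mem s1 a)"
    using Cons.prems h by (intro Cons.IH) auto
  have "cfg_mem s1 (Suc (cfg_mem s p) + j) = cfg_mem s (Suc (cfg_mem s p) + j)" for j
    using Cons.prems by (intro h) auto
  then show ?case
    unfolding eq using IH h Cons.prems by (auto simp: nth_Cons split: nat.split)
qed (simp add: load_list_def)

lemma count_eqs_correct:
  assumes "cfg_mem s 2 = 1" "\<forall>(a, b)\<in>set ps. a \<notin> {11, 12, 13} \<and> b \<notin> {11, 12, 13}"
  shows "cfg_in (fold exec (count_eqs ps) s) = cfg_in s \<and>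
    cfg_out (fold exec (count_eqs ps) s) = cfg_out s \<and>
    cfg_mem (fold exec (count_eqs ps) s) 11 =
      cfg_mem s 11 + (\<Sum>(a, b)\<leftarrow>ps. of_bool (cfg_mem s a = cfg_mem s b)) \<and>
    (\<forall>a. a \<notin> {11, 12, 13} \<longrightarrow> cfg_mem (fold exec (count_eqs ps) s) a = cfg_mem s a)"
  using assms
proof (induction ps arbitrary: s)
  case (Cons ab ps)
  obtain a b where ab: "ab = (a, b)" by force
  define s1 where "s1 = fold exec [Sub 12 a b, Sub 13 b a, Add 12 12 13, Sub 12 2 12, Add 11 11 12] s"
  have eq: "fold exec (count_eqs (ab # ps)) s = fold exec (count_eqs ps) s1"
    by (simp add: count_eqs_def s1_def ab)
  have h: "cfg_mem s1 2 = 1" "cfg_mem s1 11 = cfg_mem s 11 + of_bool (cfg_mem s a = cfg_mem s b)"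
    "\<And>a. a \<notin> {11, 12, 13} \<Longrightarrow> cfg_mem s1 a = cfg_mem s a" "cfg_in s1 = cfg_in s" "cfg_out s1 = cfg_out s"
    using Cons.prems ab by (auto simp: s1_def)
  have IH: "cfg_in (fold exec (count_eqs ps) s1) = cfg_in s1 \<and>
    cfg_out (fold exec (count_eqs ps) s1) = cfg_out s1 \<and>
    cfg_mem (fold exec (count_eqs ps) s1) 11 =
      cfg_mem s1 11 + (\<Sum>(a, b)\<leftarrow>ps. of_bool (cfg_mem s1 a = cfg_mem s1 b)) \<and>
    (\<forall>a. a \<notin> {11, 12, 13} \<longrightarrow> cfg_mem (fold exec (count_eqs ps) s1) a = cfg_mem s1 a)"
    using Cons.prems h by (intro Cons.IH) auto
  have "(\<Sum>(a, b)\<leftarrow>ps. of_bool (cfg_mem s1 a = cfg_mem s1 b)) =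
        (\<Sum>(a, b)\<leftarrow>ps. of_bool (cfg_mem s a = cfg_mem s b) :: nat)"
    using Cons.prems h(3) by (intro arg_cong[where f = sum_list] map_cong) auto
  then show ?case
    unfolding eq using IH h ab by simp
qed (simp add: count_eqs_def)

text \<open>The parity of the word records the sign and half of it the variable, which makes it
  injective.\<close>

fun lit_word :: "literal \<Rightarrow> nat" where
  "lit_word (Pos l) = l + l + 1"
| "lit_word (Neg l) = l + l"

definition slot_words :: "literal list \<Rightarrow> nat list" where
  "slot_words s = concat (map (\<lambda>l. [lit_word l, lit_word (neg_lit l)]) s)"

definition table :: "clause list \<Rightarrow> nat list" where
  "table cs = concat (map slot_words (slots cs))"

text \<open>The source registers of the 42 table words of a clause: 20, 22, 24 hold its literals and
  21, 23, 25 their negations, and a \<open>False\<close> in the pattern swaps a pair.\<close>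

definition slot_regs :: "nat list" where
  "slot_regs = concat (map (\<lambda>(b1, b2, b3).
     [if b1 then 20 else 21, if b1 then 21 else 20, if b2 then 22 else 23, if b2 then 23 else 22,
      if b3 then 24 else 25, if b3 then 25 else 24]) patterns)"

text \<open>Each pair occurs twice, which yields the factor 2 of \<^const>\<open>conflicts\<close> in \<^const>\<open>entry\<close>.\<close>

definition pair_regs :: "(nat \<times> nat) list" where
  "pair_regs = concat (map (\<lambda>(a, b). [(a, b), (a, b)])
     [(20, 27), (20, 29), (20, 31), (22, 27), (22, 29), (22, 31), (24, 27), (24, 29), (24, 31)])"

text \<open>The first \<open>Read 4\<close> steps over the number of variables, the second keeps the
  number of clauses. Registers 0 and 2 contain the words 0 and 1 of \<open>Neg 0\<close> and
  \<open>Pos 0\<close>, stored as slot 0.\<close>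

definition init_block :: "instr list" where
  "init_block = [Const 2 1, Read 4, Read 4, Const 3 1, Const 9 32] @ store_list [0, 2, 0, 2, 0, 2] @ [Copy 5 4]"

text \<open>For sign bit \<open>s\<close> and variable \<open>l\<close>, the two registers receive
  \<open>2 l + s\<close> and \<open>2 l + (1 - s)\<close>.\<close>

definition read_lit :: "nat \<Rightarrow> instr list" where
  "read_lit r = [Read 14, Read 15, Add r 15 15, Sub 12 2 14, Add (Suc r) r 12, Add r r 14]"

definition clause_block :: "instr list" where
  "clause_block =
     [Sub 5 5 2, Const 12 7, Add 3 3 12] @ read_lit 20 @ read_lit 22 @ read_lit 24 @ store_list slot_regs"

text \<open>Five doublings give \<open>32 d\<close>; registers 14 and 15 become the targets of a
  slot and of coordinate 0.\<close>

definition param_block :: "instr list" where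
  "param_block = [Add 1 3 3, Add 1 1 1, Add 1 1 1, Add 1 1 1, Add 1 1 1, Add 14 1 2, Add 15 14 4, Add 15 15 2, Write 3]"

text \<open>Register 12 holds \<open>1\<close> on the diagonal and \<open>0\<close> elsewhere, so \<open>Load 11 12\<close> fetches the diagonal
  term from address 1 or \<open>0\<close> from address 0 without a branch.\<close>

definition entry_block :: "nat \<Rightarrow> instr list" where
  "entry_block e =
     (if e = 1 then [Copy 11 12]
      else [Load 11 12, Sub 12 2 7, Add 11 11 12, Sub 12 2 8, Add 11 11 12] @ count_eqs pair_regs)"

definition write_matrix :: "nat \<Rightarrow> code" where
  "write_matrix e =
     seqc (block [Const 7 0, Const 9 32, Copy 5 3])
       (loopc 5
         (seqc (block ([Sub 5 5 2] @ load_list 9 [20, 21, 22, 23, 24, 25] @ [Const 8 0, Const 10 32, Copy 6 3]))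
           (seqc
             (loopc 6 (block ([Sub 6 6 2] @ load_list 10 [26, 27, 28, 29, 30, 31] @
                [Sub 12 7 8, Sub 13 8 7, Add 12 12 13, Sub 12 2 12] @ entry_block e @
                [Write 0, Write 11, Write 2, Add 8 8 2])))
             (block [Add 7 7 2]))))"

text \<open>The first entry comes from register \<open>a\<close> and all later ones from
  \<open>b\<close>, because the target is constant away from coordinate 0.\<close>

definition write_vector :: "nat \<Rightarrow> nat \<Rightarrow> code" where
  "write_vector a b =
     seqc (block [Copy 11 a, Copy 5 3]) (loopc 5 (block [Sub 5 5 2, Write 0, Write 11, Write 2, Copy 11 b]))"

definition program :: code where
  "program =
     seqc (block init_block) (seqc (loopc 5 (block clause_block)) (seqc (block param_block)
       (seqc (write_matrix 1) (seqc (write_vector 2 2) (seqc (write_matrix 2) (write_vector 15 14))))))"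

section \<open>The table in memory\<close>

definition has_table :: "(nat \<Rightarrow> nat) \<Rightarrow> nat list \<Rightarrow> bool" where
  "has_table m ws \<longleftrightarrow> (\<forall>a<length ws. m (32 + a) = ws ! a)"

lemma has_table_append:
  "has_table m (ws @ ws') \<longleftrightarrow> has_table m ws \<and> (\<forall>a<length ws'. m (32 + (length ws + a)) = ws' ! a)"
proof -
  have "(\<forall>a<length ws + length ws'. P a) \<longleftrightarrow> (\<forall>a<length ws. P a) \<and> (\<forall>a<length ws'. P (length ws + a))" for P
  proof (intro iffI conjI allI impI)
    fix a assume P: "(\<forall>a<length ws. P a) \<and> (\<forall>a<length ws'. P (length ws + a))" and "a < length ws + length ws'"
    then show "P a"
      using P[THEN conjunct2, rule_format, of "a - length ws"] by (cases "a < length ws") auto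
  qed auto
  then show ?thesis by (simp add: has_table_def nth_append)
qed

lemma lit_word_eq_iff [simp]: "lit_word l = lit_word l' \<longleftrightarrow> l = l'"
  by (cases l; cases l') (simp_all, presburger+)

lemma length_slot_words: "length (slot_words s) = 2 * length s"
  by (induction s) (auto simp: slot_words_def)

lemma length_table: "length (table cs) = 6 * (7 * length cs + 1)"
proof -
  have "\<forall>ws\<in>set (map slot_words (slots cs)). length ws = 6"
    by (auto simp: length_slot_words slots_def)
  then show ?thesis
    unfolding table_def using length_concat_uniform[of "map slot_words (slots cs)" 6] by (simp add: length_slots)
qed

lemma nth_table:
  assumes "i < 7 * length cs + 1" "u < 6"
  shows "table cs ! (6 * i + u) = slot_words (slots cs ! i) ! u"
proof -
  have "\<forall>ws\<in>set (map slot_words (slots cs)). length ws = 6"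
    by (auto simp: length_slot_words slots_def)
  then show ?thesis
    unfolding table_def using nth_concat_uniform[of "map slot_words (slots cs)" 6 i u] assms by (simp add: length_slots)
qed

lemma table_Nil: "table [] = [0, 1, 0, 1, 0, 1]"
  by (simp add: table_def slots_def slot_words_def)

lemma table_snoc: "table (cs @ [c]) = table cs @ concat (map slot_words (clause_slots c))"
  by (simp add: table_def slots_def)

lemma read_lit_correct:
  assumes "cfg_mem s 2 = 1" "cfg_in s = literal_code l @ ws" "r \<ge> 20"
  shows "cfg_in (fold exec (read_lit r) s) = ws \<and>
    cfg_out (fold exec (read_lit r) s) = cfg_out s \<and>
    cfg_mem (fold exec (read_lit r) s) r = lit_word l \<and>
    cfg_mem (fold exec (read_lit r) s) (Suc r) = lit_word (neg_lit l) \<and>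
    (\<forall>a. a \<notin> {12, 14, 15, r, Suc r} \<longrightarrow> cfg_mem (fold exec (read_lit r) s) a = cfg_mem s a)"
  using assms by (cases l) (simp_all add: read_lit_def)

section \<open>Reading the formula and building the table\<close>

definition read_inv :: "clause list \<Rightarrow> nat \<Rightarrow> assn" where
  "read_inv cs c m i out \<longleftrightarrow>
     m 0 = 0 \<and> m 2 = 1 \<and> m 3 = 7 * c + 1 \<and> m 4 = length cs \<and> m 9 = 32 + 6 * (7 * c + 1) \<and>
     has_table m (table (take c cs)) \<and> i = concat (map clause_code (drop c cs)) \<and> out = []"

lemma init_correct:
  "hoare (\<lambda>m i out. m = (\<lambda>_. 0) \<and> i = sat3_code x \<and> out = []) (block init_block) 18
     (\<lambda>m i out. read_inv (clauses x) 0 m i out \<and> m 5 = length (clauses x))"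
proof (rule hoare_block)
  show "\<forall>a\<in>set init_block. \<not> is_jump a"
    using not_jump_macros by (auto simp: init_block_def)
  show "length init_block \<le> 18" by (simp add: init_block_def length_macros)
  fix s
  assume "holds (\<lambda>m i out. m = (\<lambda>_. 0) \<and> i = sat3_code x \<and> out = []) s"
  then have s: "cfg_mem s = (\<lambda>_. 0)" "cfg_in s = sat3_code x" "cfg_out s = []"
    by (simp_all add: holds_def)
  define s1 where "s1 = fold exec [Const 2 1, Read 4, Read 4, Const 3 1, Const 9 32] s"
  have s1: "cfg_mem s1 0 = 0" "cfg_mem s1 2 = 1" "cfg_mem s1 3 = 1" "cfg_mem s1 4 = length (clauses x)"
    "cfg_mem s1 9 = 32" "cfg_in s1 = concat (map clause_code (clauses x))" "cfg_out s1 = []"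
    using s by (simp_all add: s1_def sat3_code_def)
  define s2 where "s2 = fold exec (store_list [0, 2, 0, 2, 0, 2]) s1"
  have s2: "cfg_in s2 = cfg_in s1 \<and> cfg_out s2 = cfg_out s1 \<and>
      cfg_mem s2 9 = cfg_mem s1 9 + length [0 :: nat, 2, 0, 2, 0, 2] \<and>
      (\<forall>j<length [0 :: nat, 2, 0, 2, 0, 2]. cfg_mem s2 (cfg_mem s1 9 + j) = cfg_mem s1 ([0, 2, 0, 2, 0, 2] ! j)) \<and>
      (\<forall>a<cfg_mem s1 9. a \<noteq> 9 \<longrightarrow> cfg_mem s2 a = cfg_mem s1 a)"
    unfolding s2_def by (rule store_list_correct) (use s1 in auto)
  have "cfg_mem s1 ([0, 2, 0, 2, 0, 2] ! j) = [0, 1, 0, 1, 0, 1] ! j" if "j < 6" for j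
    using that s1 by (auto simp: less_Suc_eq numeral_eq_Suc)
  then have "has_table (cfg_mem s2) (table (take 0 (clauses x)))"
    using s2 s1 by (simp add: has_table_def table_Nil)
  moreover have "fold exec init_block s = exec (Copy 5 4) s2"
    by (simp add: init_block_def s1_def s2_def)
  ultimately show "holds (\<lambda>m i out. read_inv (clauses x) 0 m i out \<and> m 5 = length (clauses x)) (fold exec init_block s)"
    using s1 s2 by (simp add: holds_def read_inv_def has_table_def)
qed

lemma clause_correct:
  assumes c: "c < length cs"
  shows "hoare (\<lambda>m i out. read_inv cs c m i out \<and> m 5 = length cs - c) (block clause_block) 105
     (\<lambda>m i out. read_inv cs (Suc c) m i out \<and> m 5 = length cs - Suc c)"
proof (rule hoare_block)
  have len: "length slot_regs = 42" by (simp add: slot_regs_def patterns_def)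
  show "\<forall>a\<in>set clause_block. \<not> is_jump a"
    using not_jump_macros by (auto simp: clause_block_def read_lit_def)
  \<comment> \<open>\<open>105 = 3 + 3 * 6 + 2 * 42\<close>: the counters, three literals and 42
    stored words.\<close>
  show "length clause_block \<le> 105" by (simp add: clause_block_def read_lit_def length_macros len)
  fix s
  assume "holds (\<lambda>m i out. read_inv cs c m i out \<and> m 5 = length cs - c) s"
  then have s: "cfg_mem s 0 = 0" "cfg_mem s 2 = 1" "cfg_mem s 3 = 7 * c + 1" "cfg_mem s 4 = length cs"
    "cfg_mem s 9 = 32 + 6 * (7 * c + 1)" "has_table (cfg_mem s) (table (take c cs))"
    "cfg_in s = concat (map clause_code (drop c cs))" "cfg_out s = []" "cfg_mem s 5 = length cs - c"
    by (simp_all add: holds_def read_inv_def)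
  obtain l1 l2 l3 where l: "cs ! c = (l1, l2, l3)" by (cases "cs ! c")
  define r0 where "r0 = fold exec [Sub 5 5 2, Const 12 7, Add 3 3 12] s"
  define r1 where "r1 = fold exec (read_lit 20) r0"
  define r2 where "r2 = fold exec (read_lit 22) r1"
  define t where "t = fold exec (read_lit 24) r2"
  let ?rest = "concat (map clause_code (drop (Suc c) cs))"
  have "drop c cs = (l1, l2, l3) # drop (Suc c) cs"
    using c l by (metis Cons_nth_drop_Suc)
  then have r0: "cfg_in r0 = literal_code l1 @ literal_code l2 @ literal_code l3 @ ?rest" "cfg_out r0 = []"
    "cfg_mem r0 2 = 1" "cfg_mem r0 3 = 7 * Suc c + 1" "cfg_mem r0 5 = length cs - Suc c"
    "\<And>a. a \<notin> {3, 5, 12} \<Longrightarrow> cfg_mem r0 a = cfg_mem s a"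
    using s c by (simp_all add: r0_def)
  note r1 = read_lit_correct[OF r0(3,1), of 20, folded r1_def]
  have "cfg_mem r1 2 = 1" "cfg_in r1 = literal_code l2 @ literal_code l3 @ ?rest"
    using r1 r0(3) by simp_all
  note r2 = read_lit_correct[OF this, of 22, folded r2_def]
  have "cfg_mem r2 2 = 1" "cfg_in r2 = literal_code l3 @ ?rest"
    using r1 r2 r0(3) by simp_all
  note r3 = read_lit_correct[OF this, of 24, folded t_def]
  have t_regs: "cfg_mem t 20 = lit_word l1" "cfg_mem t 21 = lit_word (neg_lit l1)"
    "cfg_mem t 22 = lit_word l2" "cfg_mem t 23 = lit_word (neg_lit l2)"
    "cfg_mem t 24 = lit_word l3" "cfg_mem t 25 = lit_word (neg_lit l3)"
    using r1 r2 r3 by simp_all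
  have t: "cfg_mem t 0 = 0" "cfg_mem t 2 = 1" "cfg_mem t 3 = 7 * Suc c + 1" "cfg_mem t 4 = length cs"
    "cfg_mem t 9 = 32 + 6 * (7 * c + 1)" "cfg_mem t 5 = length cs - Suc c"
    "cfg_in t = ?rest" "cfg_out t = []"
    using r0 r1 r2 r3 s by simp_all
  have t_high: "cfg_mem t (32 + a) = cfg_mem s (32 + a)" for a
    using r0(6) r1 r2 r3 by simp
  define u where "u = fold exec (store_list slot_regs) t"
  have regs: "set slot_regs \<subseteq> {..<32} - {9}" by (auto simp: slot_regs_def patterns_def)
  have u: "cfg_in u = cfg_in t \<and> cfg_out u = cfg_out t \<and>
      cfg_mem u 9 = cfg_mem t 9 + length slot_regs \<and>
      (\<forall>j<length slot_regs. cfg_mem u (cfg_mem t 9 + j) = cfg_mem t (slot_regs ! j)) \<and>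
      (\<forall>a<cfg_mem t 9. a \<noteq> 9 \<longrightarrow> cfg_mem u a = cfg_mem t a)"
    unfolding u_def by (rule store_list_correct) (use t regs in auto)
  \<comment> \<open>The contents of the listed registers are exactly the table segment of the new
    clause.\<close>
  have words: "map (cfg_mem t) slot_regs = concat (map slot_words (clause_slots (cs ! c)))"
    using t_regs by (simp add: slot_regs_def patterns_def l slot_words_def orient_def)
  have len_table: "length (table (take c cs)) = 6 * (7 * c + 1)"
    using c by (simp add: length_table)
  have "has_table (cfg_mem u) (table (take c cs))"
    unfolding has_table_def
  proof (intro allI impI)
    fix a assume a: "a < length (table (take c cs))"
    have "cfg_mem u (32 + a) = cfg_mem t (32 + a)"
      using u a t(5) len_table by simp
    then show "cfg_mem u (32 + a) = table (take c cs) ! a"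
      using s(6) a t_high by (simp add: has_table_def)
  qed
  moreover have "cfg_mem u (32 + (length (table (take c cs)) + a)) =
      concat (map slot_words (clause_slots (cs ! c))) ! a" if "a < length slot_regs" for a
  proof -
    have "cfg_mem u (32 + (length (table (take c cs)) + a)) = cfg_mem t (slot_regs ! a)"
      using u that t(5) len_table by (metis add.assoc)
    then show ?thesis using that by (simp flip: words)
  qed
  moreover have "length (concat (map slot_words (clause_slots (cs ! c)))) = length slot_regs"
    by (simp flip: words)
  ultimately have "has_table (cfg_mem u) (table (take (Suc c) cs))"
    using c by (simp add: take_Suc_conv_app_nth table_snoc has_table_append)
  moreover have "fold exec clause_block s = u"
    by (simp add: clause_block_def r0_def r1_def r2_def t_def u_def)
  ultimately show "holds (\<lambda>m i out. read_inv cs (Suc c) m i out \<and> m 5 = length cs - Suc c) (fold exec clause_block s)"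
    using t u len by (simp add: holds_def read_inv_def)
qed

section \<open>Writing the output\<close>

definition frame :: "clause list \<Rightarrow> (nat \<Rightarrow> nat) \<Rightarrow> bool" where
  "frame cs m \<longleftrightarrow> m 0 = 0 \<and> m 1 = 32 * (7 * length cs + 1) \<and> m 2 = 1 \<and> m 3 = 7 * length cs + 1 \<and>
     m 14 = 32 * (7 * length cs + 1) + 1 \<and> m 15 = 32 * (7 * length cs + 1) + 1 + (length cs + 1) \<and>
     has_table m (table cs)"

text \<open>The remaining registers below 32 serve as counters, pointers and scratch space, and may
  change freely while the output is written.\<close>

lemma frame_cong:
  assumes "\<And>a. a \<in> {0, 1, 2, 3, 14, 15} \<or> a \<ge> 32 \<Longrightarrow> m' a = m a"
  shows "frame cs m' \<longleftrightarrow> frame cs m"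
  using assms by (simp add: frame_def has_table_def)

lemma param_correct:
  "hoare (read_inv cs (length cs)) (block param_block) 9 (\<lambda>m i out. frame cs m \<and> out = [7 * length cs + 1])"
  by (rule hoare_block) (auto simp: param_block_def holds_def read_inv_def frame_def has_table_def)

lemma vector_correct:
  assumes ab: "a \<in> {2, 14, 15}" "b \<in> {2, 14, 15}"
    and f: "\<And>m. frame cs m \<Longrightarrow> m a = f 0" "\<And>m i. frame cs m \<Longrightarrow> m b = f (Suc i)"
  shows "hoare (\<lambda>m i out. frame cs m \<and> out = out0) (write_vector a b) (2 + ((7 * length cs + 1) * 7 + 1))
           (\<lambda>m i out. frame cs m \<and> out = out0 @ concat (vector_codes (7 * length cs + 1) f))"
proof -
  define d where "d = 7 * length cs + 1"
  \<comment> \<open>Register 11 already holds the entry to be written next, as it is reloaded at the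
    end of each round.\<close>
  define vec_inv :: "nat \<Rightarrow> assn" where
    "vec_inv j m i out \<longleftrightarrow> frame cs m \<and> m 11 = f j \<and> out = out0 @ concat (vector_codes j f)" for j m i out
  have frame_2: "frame cs m \<Longrightarrow> m 0 = 0 \<and> m 2 = 1 \<and> m 3 = d" for m
    by (simp add: frame_def d_def)
  have frame_upd: "frame cs (m(r := v)) = frame cs m" if "r \<in> {5, 11}" for m r v
    using that by (intro frame_cong) auto
  have "hoare (\<lambda>m i out. frame cs m \<and> out = out0) (block [Copy 11 a, Copy 5 3]) 2 (\<lambda>m i out. vec_inv 0 m i out \<and> m 5 = d)"
  proof (rule hoare_block)
    fix s assume "holds (\<lambda>m i out. frame cs m \<and> out = out0) s"
    then show "holds (\<lambda>m i out. vec_inv 0 m i out \<and> m 5 = d) (fold exec [Copy 11 a, Copy 5 3] s)"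
      using frame_2 f by (simp add: holds_def vec_inv_def vector_codes_def frame_upd)
  qed auto
  moreover have "hoare (\<lambda>m i out. vec_inv 0 m i out \<and> m 5 = d)
      (loopc 5 (block [Sub 5 5 2, Write 0, Write 11, Write 2, Copy 11 b])) (d * (5 + 2) + 1) (vec_inv d)"
  proof (rule hoare_loop, rule hoare_block)
    fix j s assume "j < d" and s: "holds (\<lambda>m i out. vec_inv j m i out \<and> m 5 = d - j) s"
    then have m: "frame cs (cfg_mem s)" "cfg_mem s 11 = f j" "cfg_mem s 5 = d - j"
      "cfg_out s = out0 @ concat (vector_codes j f)"
      by (simp_all add: holds_def vec_inv_def)
    then have "cfg_mem s 0 = 0" "cfg_mem s 2 = 1" "cfg_mem s b = f (Suc j)" "b \<noteq> 5"
      using frame_2 f(2) ab(2) by auto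
    then show "holds (\<lambda>m i out. vec_inv (Suc j) m i out \<and> m 5 = d - Suc j)
        (fold exec [Sub 5 5 2, Write 0, Write 11, Write 2, Copy 11 b] s)"
      using m by (simp add: holds_def vec_inv_def vector_codes_def frame_upd)
  qed auto
  ultimately have "hoare (\<lambda>m i out. frame cs m \<and> out = out0) (write_vector a b) (2 + (d * (5 + 2) + 1)) (vec_inv d)"
    unfolding write_vector_def by (rule hoare_seq)
  then show ?thesis
    by (rule hoare_conseq) (auto simp: vec_inv_def d_def)
qed

lemma entry_block_correct:
  assumes frame: "frame cs (cfg_mem s)" and ij: "i < 7 * length cs + 1" "j < 7 * length cs + 1"
    and regs: "cfg_mem s 7 = i" "cfg_mem s 8 = j" "cfg_mem s 12 = of_bool (i = j)"
    and words: "\<And>u. u < 6 \<Longrightarrow> cfg_mem s (20 + u) = table cs ! (6 * i + u)"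
      "\<And>u. u < 6 \<Longrightarrow> cfg_mem s (26 + u) = table cs ! (6 * j + u)"
  shows "cfg_in (fold exec (entry_block e) s) = cfg_in s \<and>
    cfg_out (fold exec (entry_block e) s) = cfg_out s \<and>
    cfg_mem (fold exec (entry_block e) s) 11 = entry cs e i j \<and>
    (\<forall>a. a \<notin> {11, 12, 13} \<longrightarrow> cfg_mem (fold exec (entry_block e) s) a = cfg_mem s a)"
proof (cases "e = 1")
  case True
  then show ?thesis using regs by (simp add: entry_block_def entry_def)
next
  case False
  obtain l1 l2 l3 where l: "slots cs ! i = [l1, l2, l3]"
    using length_slot[OF ij(1)] by (auto simp: numeral_3_eq_3 length_Suc_conv)
  obtain l1' l2' l3' where l': "slots cs ! j = [l1', l2', l3']"
    using length_slot[OF ij(2)] by (auto simp: numeral_3_eq_3 length_Suc_conv)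
  \<comment> \<open>The row slot supplies its literals and the column slot its negated literals, so
    equal words mean a complementary pair.\<close>
  have i_regs: "cfg_mem s 20 = lit_word l1" "cfg_mem s 22 = lit_word l2" "cfg_mem s 24 = lit_word l3"
    using words(1)[of 0] words(1)[of 2] words(1)[of 4] nth_table[OF ij(1), of 0] nth_table[OF ij(1), of 2]
      nth_table[OF ij(1), of 4] by (simp_all add: l slot_words_def)
  have j_regs: "cfg_mem s 27 = lit_word (neg_lit l1')" "cfg_mem s 29 = lit_word (neg_lit l2')"
    "cfg_mem s 31 = lit_word (neg_lit l3')"
    using words(2)[of 1] words(2)[of 3] words(2)[of 5] nth_table[OF ij(2), of 1] nth_table[OF ij(2), of 3]
      nth_table[OF ij(2), of 5] by (simp_all add: l' slot_words_def)
  define t where "t = fold exec [Load 11 12, Sub 12 2 7, Add 11 11 12, Sub 12 2 8, Add 11 11 12] s"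
  have fr: "cfg_mem s 0 = 0" "cfg_mem s 1 = 32 * (7 * length cs + 1)" "cfg_mem s 2 = 1"
    using frame by (simp_all add: frame_def)
  have t: "cfg_in t = cfg_in s" "cfg_out t = cfg_out s" "\<And>a. a \<notin> {11, 12, 13} \<Longrightarrow> cfg_mem t a = cfg_mem s a"
    by (simp_all add: t_def)
  have "1 - i = of_bool (i = 0)" "1 - j = of_bool (j = 0)" by auto
  moreover have "cfg_mem s (cfg_mem s 12) = 32 * (7 * length cs + 1) * of_bool (i = j)"
    using fr regs by simp
  ultimately have t_11: "cfg_mem t 11 =
      32 * (7 * length cs + 1) * of_bool (i = j) + of_bool (i = 0) + of_bool (j = 0)"
    using fr regs(1,2) by (simp add: t_def)
  have "cfg_mem t 2 = 1" using t(3) fr by simp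
  moreover have "\<forall>(a, b)\<in>set pair_regs. a \<notin> {11, 12, 13} \<and> b \<notin> {11, 12, 13}"
    by (simp add: pair_regs_def)
  ultimately have u: "cfg_in (fold exec (count_eqs pair_regs) t) = cfg_in t \<and>
    cfg_out (fold exec (count_eqs pair_regs) t) = cfg_out t \<and>
    cfg_mem (fold exec (count_eqs pair_regs) t) 11 =
      cfg_mem t 11 + (\<Sum>(a, b)\<leftarrow>pair_regs. of_bool (cfg_mem t a = cfg_mem t b)) \<and>
    (\<forall>a. a \<notin> {11, 12, 13} \<longrightarrow> cfg_mem (fold exec (count_eqs pair_regs) t) a = cfg_mem t a)"
    by (rule count_eqs_correct)
  have "(\<Sum>(a, b)\<leftarrow>pair_regs. of_bool (cfg_mem t a = cfg_mem t b)) = 2 * conflicts (slots cs ! i) (slots cs ! j)"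
    unfolding l l' conflicts_def by (simp add: pair_regs_def t(3) i_regs j_regs)
  moreover have "fold exec (entry_block e) s = fold exec (count_eqs pair_regs) t"
    using False by (simp add: entry_block_def t_def)
  ultimately show ?thesis
    using False t t_11 u by (simp add: entry_def)
qed

lemma entry_block_simple: "\<forall>a\<in>set (entry_block e). \<not> is_jump a" "length (entry_block e) \<le> 95"
  using not_jump_macros by (auto simp: entry_block_def length_macros pair_regs_def)

lemma matrix_codes_Suc: "matrix_codes (Suc n) d f = matrix_codes n d f @ vector_codes d (f n)"
  by (simp add: matrix_codes_def vector_codes_def)

text \<open>The state after \<open>j\<close> entries of row \<open>i\<close>. Loading the row slot
  has already moved pointer 9 to the next row, and the outer counter has already been
  decremented.\<close>

definition inner_inv :: "clause list \<Rightarrow> nat \<Rightarrow> nat list \<Rightarrow> nat \<Rightarrow> nat \<Rightarrow> assn" where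
  "inner_inv cs e out0 i j m inp out \<longleftrightarrow>
     frame cs m \<and> m 7 = i \<and> m 9 = 32 + 6 * Suc i \<and> m 5 = 7 * length cs + 1 - Suc i \<and>
     (\<forall>u<6. m (20 + u) = table cs ! (6 * i + u)) \<and> m 8 = j \<and> m 10 = 32 + 6 * j \<and>
     out = out0 @ concat (vector_codes j (entry cs e i))"

definition inner_block :: "nat \<Rightarrow> instr list" where
  "inner_block e = [Sub 6 6 2] @ load_list 10 [26, 27, 28, 29, 30, 31] @
     [Sub 12 7 8, Sub 13 8 7, Add 12 12 13, Sub 12 2 12] @ entry_block e @
     [Write 0, Write 11, Write 2, Add 8 8 2]"

lemma all_less_6: "(\<forall>u<6. P u) \<longleftrightarrow> P 0 \<and> P 1 \<and> P 2 \<and> P 3 \<and> P 4 \<and> P (5 :: nat)"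
  by (auto simp: numeral_eq_Suc All_less_Suc)

lemma inner_correct:
  assumes i: "i < 7 * length cs + 1" and j: "j < 7 * length cs + 1"
  shows "hoare (\<lambda>m inp out. inner_inv cs e out0 i j m inp out \<and> m 6 = 7 * length cs + 1 - j)
           (block (inner_block e)) 116
           (\<lambda>m inp out. inner_inv cs e out0 i (Suc j) m inp out \<and> m 6 = 7 * length cs + 1 - Suc j)"
proof (rule hoare_block)
  define d where "d = 7 * length cs + 1"
  show "\<forall>a\<in>set (inner_block e). \<not> is_jump a"
    using not_jump_macros entry_block_simple by (auto simp: inner_block_def)
  \<comment> \<open>\<open>116 = 1 + 12 + 4 + 95 + 4\<close>, one summand for each piece of the
    block.\<close>
  show "length (inner_block e) \<le> 116"
    using entry_block_simple(2)[of e] by (simp add: inner_block_def length_macros)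
  fix s
  assume "holds (\<lambda>m inp out. inner_inv cs e out0 i j m inp out \<and> m 6 = 7 * length cs + 1 - j) s"
  then have s: "frame cs (cfg_mem s)" "cfg_mem s 7 = i" "cfg_mem s 9 = 32 + 6 * Suc i" "cfg_mem s 5 = d - Suc i"
    "\<forall>u<6. cfg_mem s (20 + u) = table cs ! (6 * i + u)" "cfg_mem s 8 = j" "cfg_mem s 10 = 32 + 6 * j"
    "cfg_out s = out0 @ concat (vector_codes j (entry cs e i))" "cfg_mem s 6 = d - j"
    by (simp_all add: holds_def inner_inv_def d_def)
  let ?rs = "[26, 27, 28, 29, 30, 31] :: nat list"
  define s1 where "s1 = exec (Sub 6 6 2) s"
  define s2 where "s2 = fold exec (load_list 10 ?rs) s1"
  define s3 where "s3 = fold exec [Sub 12 7 8, Sub 13 8 7, Add 12 12 13, Sub 12 2 12] s2"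
  define s4 where "s4 = fold exec (entry_block e) s3"
  have const: "cfg_mem s 0 = 0" "cfg_mem s 2 = 1" using s(1) by (simp_all add: frame_def)
  have s1: "cfg_mem s1 6 = d - Suc j" "\<And>a. a \<noteq> 6 \<Longrightarrow> cfg_mem s1 a = cfg_mem s a"
    "cfg_in s1 = cfg_in s" "cfg_out s1 = cfg_out s"
    using s(9) const by (simp_all add: s1_def)
  have s2: "cfg_in s2 = cfg_in s1 \<and> cfg_out s2 = cfg_out s1 \<and>
    cfg_mem s2 10 = cfg_mem s1 10 + length ?rs \<and>
    (\<forall>j<length ?rs. cfg_mem s2 (?rs ! j) = cfg_mem s1 (cfg_mem s1 10 + j)) \<and>
    (\<forall>a. a \<notin> insert 10 (set ?rs) \<longrightarrow> cfg_mem s2 a = cfg_mem s1 a)"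
    unfolding s2_def by (rule load_list_correct) (use s(7) s1(2) const in auto)
  have s2_keep: "cfg_mem s2 a = cfg_mem s a" if "a \<notin> {6, 10, 26, 27, 28, 29, 30, 31}" for a
    using s2 s1(2) that by simp
  have table: "cfg_mem s (32 + (6 * j + u)) = table cs ! (6 * j + u)" if "u < 6" for u
    using s(1) that j by (auto simp: frame_def has_table_def length_table)
  have words: "cfg_mem s2 (?rs ! u) = table cs ! (6 * j + u)" if "u < 6" for u
    using s2 s1(2) s(7) table[OF that] that by (simp add: add.assoc)
  have s2_words: "\<forall>u<6. cfg_mem s2 (26 + u) = table cs ! (6 * j + u)"
    unfolding all_less_6
    using words[of 0] words[of 1] words[of 2] words[of 3] words[of 4] words[of 5] by simp
  have s3: "cfg_mem s3 12 = of_bool (i = j)" "\<And>a. a \<notin> {12, 13} \<Longrightarrow> cfg_mem s3 a = cfg_mem s2 a"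
    "cfg_in s3 = cfg_in s2" "cfg_out s3 = cfg_out s2"
    using s2_keep const s(2,6) by (auto simp: s3_def)
  have s3_keep: "cfg_mem s3 a = cfg_mem s a" if "a \<notin> {6, 10, 12, 13, 26, 27, 28, 29, 30, 31}" for a
    using s3(2) s2_keep that by simp
  have s4: "cfg_in s4 = cfg_in s3 \<and> cfg_out s4 = cfg_out s3 \<and> cfg_mem s4 11 = entry cs e i j \<and>
    (\<forall>a. a \<notin> {11, 12, 13} \<longrightarrow> cfg_mem s4 a = cfg_mem s3 a)"
    unfolding s4_def
  proof (rule entry_block_correct)
    show "frame cs (cfg_mem s3)"
      using s(1) s3_keep by (subst frame_cong[of _ "cfg_mem s"]) auto
    show "cfg_mem s3 (20 + u) = table cs ! (6 * i + u)" if "u < 6" for u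
      using s(5) s3_keep[of "20 + u"] that by simp
    show "cfg_mem s3 (26 + u) = table cs ! (6 * j + u)" if "u < 6" for u
      using s2_words s3(2)[of "26 + u"] that by simp
  qed (use i j s(2,6) s3(1) s3_keep in auto)
  have s4_keep: "cfg_mem s4 a = cfg_mem s a" if "a \<notin> {6, 10, 11, 12, 13, 26, 27, 28, 29, 30, 31}" for a
    using s4 s3_keep that by simp
  have s4_10: "cfg_mem s4 6 = d - Suc j" "cfg_mem s4 10 = 32 + 6 * Suc j"
    using s4 s3(2) s2 s1 s(7) by simp_all
  define t where "t = fold exec [Write 0, Write 11, Write 2, Add 8 8 2] s4"
  have t: "cfg_mem t 8 = Suc j" "\<And>a. a \<noteq> 8 \<Longrightarrow> cfg_mem t a = cfg_mem s4 a"
    "cfg_out t = out0 @ concat (vector_codes (Suc j) (entry cs e i))"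
    using s4 s4_keep const s(6,8) s3(4) s2 s1(4) by (simp_all add: t_def vector_codes_def)
  have "frame cs (cfg_mem t)"
    using s(1) s4_keep t(2) by (subst frame_cong[of _ "cfg_mem s"]) auto
  moreover have "fold exec (inner_block e) s = t"
    by (simp add: inner_block_def s1_def s2_def s3_def s4_def t_def)
  ultimately show "holds (\<lambda>m inp out. inner_inv cs e out0 i (Suc j) m inp out \<and> m 6 = 7 * length cs + 1 - Suc j)
      (fold exec (inner_block e) s)"
    using t s4_keep s4_10 s(2-5) unfolding holds_def inner_inv_def d_def[symmetric] by simp
qed

definition outer_inv :: "clause list \<Rightarrow> nat \<Rightarrow> nat list \<Rightarrow> nat \<Rightarrow> assn" where
  "outer_inv cs e out0 i m inp out \<longleftrightarrow>
     frame cs m \<and> m 7 = i \<and> m 9 = 32 + 6 * i \<and>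
     out = out0 @ concat (matrix_codes i (7 * length cs + 1) (entry cs e))"

lemma row_start_correct:
  assumes i: "i < 7 * length cs + 1"
  shows "hoare (\<lambda>m inp out. outer_inv cs e out0 i m inp out \<and> m 5 = 7 * length cs + 1 - i)
     (block ([Sub 5 5 2] @ load_list 9 [20, 21, 22, 23, 24, 25] @ [Const 8 0, Const 10 32, Copy 6 3])) 16
     (\<lambda>m inp out. inner_inv cs e (out0 @ concat (matrix_codes i (7 * length cs + 1) (entry cs e))) i 0 m inp out \<and>
        m 6 = 7 * length cs + 1)"
proof (rule hoare_block)
  define d where "d = 7 * length cs + 1"
  let ?rs = "[20, 21, 22, 23, 24, 25] :: nat list"
  show "\<forall>a\<in>set ([Sub 5 5 2] @ load_list 9 ?rs @ [Const 8 0, Const 10 32, Copy 6 3]). \<not> is_jump a"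
    using not_jump_macros by auto
  show "length ([Sub 5 5 2] @ load_list 9 ?rs @ [Const 8 0, Const 10 32, Copy 6 3]) \<le> 16"
    by (simp add: length_macros)
  fix s
  assume "holds (\<lambda>m inp out. outer_inv cs e out0 i m inp out \<and> m 5 = 7 * length cs + 1 - i) s"
  then have s: "frame cs (cfg_mem s)" "cfg_mem s 7 = i" "cfg_mem s 9 = 32 + 6 * i" "cfg_mem s 5 = d - i"
    "cfg_out s = out0 @ concat (matrix_codes i d (entry cs e))"
    by (simp_all add: holds_def outer_inv_def d_def)
  define s1 where "s1 = exec (Sub 5 5 2) s"
  define s2 where "s2 = fold exec (load_list 9 ?rs) s1"
  define t where "t = fold exec [Const 8 0, Const 10 32, Copy 6 3] s2"
  have const: "cfg_mem s 2 = 1" "cfg_mem s 3 = d" using s(1) by (simp_all add: frame_def d_def)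
  have s1: "cfg_mem s1 5 = d - Suc i" "\<And>a. a \<noteq> 5 \<Longrightarrow> cfg_mem s1 a = cfg_mem s a" "cfg_out s1 = cfg_out s"
    using s(4) const by (simp_all add: s1_def)
  have s2: "cfg_in s2 = cfg_in s1 \<and> cfg_out s2 = cfg_out s1 \<and>
    cfg_mem s2 9 = cfg_mem s1 9 + length ?rs \<and>
    (\<forall>j<length ?rs. cfg_mem s2 (?rs ! j) = cfg_mem s1 (cfg_mem s1 9 + j)) \<and>
    (\<forall>a. a \<notin> insert 9 (set ?rs) \<longrightarrow> cfg_mem s2 a = cfg_mem s1 a)"
    unfolding s2_def by (rule load_list_correct) (use s(3) s1(2) const in auto)
  have table: "cfg_mem s (32 + (6 * i + u)) = table cs ! (6 * i + u)" if "u < 6" for u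
    using s(1) that i by (auto simp: frame_def has_table_def length_table)
  have words: "cfg_mem s2 (?rs ! u) = table cs ! (6 * i + u)" if "u < 6" for u
    using s2 s1(2) s(3) table[OF that] that by (simp add: add.assoc)
  have s2_words: "\<forall>u<6. cfg_mem s2 (20 + u) = table cs ! (6 * i + u)"
    unfolding all_less_6
    using words[of 0] words[of 1] words[of 2] words[of 3] words[of 4] words[of 5] by simp
  have t: "cfg_mem t 8 = 0" "cfg_mem t 10 = 32" "cfg_mem t 6 = d" "cfg_out t = cfg_out s"
    "\<And>a. a \<notin> {6, 8, 10} \<Longrightarrow> cfg_mem t a = cfg_mem s2 a"
    using s2 s1 const by (simp_all add: t_def)
  have "frame cs (cfg_mem t)"
    using s(1) t(5) s2 s1(2) by (subst frame_cong[of _ "cfg_mem s"]) auto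
  moreover have "\<forall>u<6. cfg_mem t (20 + u) = table cs ! (6 * i + u)"
    using s2_words t(5) by simp
  moreover have "cfg_mem t 7 = i" "cfg_mem t 9 = 32 + 6 * Suc i" "cfg_mem t 5 = d - Suc i"
    using t(5) s2 s1 s(2,3) by simp_all
  moreover have "fold exec ([Sub 5 5 2] @ load_list 9 ?rs @ [Const 8 0, Const 10 32, Copy 6 3]) s = t"
    by (simp add: s1_def s2_def t_def)
  ultimately show "holds (\<lambda>m inp out. inner_inv cs e (out0 @ concat (matrix_codes i (7 * length cs + 1) (entry cs e))) i 0 m inp out \<and>
        m 6 = 7 * length cs + 1) (fold exec ([Sub 5 5 2] @ load_list 9 ?rs @ [Const 8 0, Const 10 32, Copy 6 3]) s)"
    using t s(5) unfolding holds_def inner_inv_def d_def[symmetric] by (simp add: vector_codes_def)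
qed

lemma matrix_correct:
  fixes cs e out0
  defines "d \<equiv> 7 * length cs + 1"
  shows "hoare (\<lambda>m inp out. frame cs m \<and> out = out0) (write_matrix e)
     (3 + (d * (16 + (d * (116 + 2) + 1 + 1) + 2) + 1))
     (\<lambda>m inp out. frame cs m \<and> out = out0 @ concat (matrix_codes d d (entry cs e)))"
proof -
  have init: "hoare (\<lambda>m inp out. frame cs m \<and> out = out0) (block [Const 7 0, Const 9 32, Copy 5 3]) 3
      (\<lambda>m inp out. outer_inv cs e out0 0 m inp out \<and> m 5 = d)"
  proof (rule hoare_block)
    fix s assume "holds (\<lambda>m inp out. frame cs m \<and> out = out0) s"
    then have s: "frame cs (cfg_mem s)" "cfg_mem s 3 = d" "cfg_out s = out0"
      by (simp_all add: holds_def frame_def d_def)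
    moreover have "frame cs (cfg_mem (fold exec [Const 7 0, Const 9 32, Copy 5 3] s))"
      using s(1) by (subst frame_cong[of _ "cfg_mem s"]) auto
    ultimately show "holds (\<lambda>m inp out. outer_inv cs e out0 0 m inp out \<and> m 5 = d)
        (fold exec [Const 7 0, Const 9 32, Copy 5 3] s)"
      by (simp add: holds_def outer_inv_def matrix_codes_def)
  qed auto
  have row_end: "hoare (inner_inv cs e (out0 @ concat (matrix_codes i d (entry cs e))) i d) (block [Add 7 7 2]) 1
      (\<lambda>m inp out. outer_inv cs e out0 (Suc i) m inp out \<and> m 5 = d - Suc i)" for i
  proof (rule hoare_block)
    fix s assume "holds (inner_inv cs e (out0 @ concat (matrix_codes i d (entry cs e))) i d) s"
    then have s: "frame cs (cfg_mem s)" "cfg_mem s 2 = 1" "cfg_mem s 7 = i" "cfg_mem s 9 = 32 + 6 * Suc i"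
      "cfg_mem s 5 = d - Suc i"
      "cfg_out s = out0 @ concat (matrix_codes (Suc i) d (entry cs e))"
      by (simp_all add: holds_def inner_inv_def frame_def d_def matrix_codes_Suc)
    moreover have "frame cs (cfg_mem (fold exec [Add 7 7 2] s))"
      using s(1) by (subst frame_cong[of _ "cfg_mem s"]) auto
    ultimately show "holds (\<lambda>m inp out. outer_inv cs e out0 (Suc i) m inp out \<and> m 5 = d - Suc i)
        (fold exec [Add 7 7 2] s)"
      unfolding holds_def outer_inv_def d_def[symmetric] by simp
  qed auto
  have "hoare (\<lambda>m inp out. outer_inv cs e out0 0 m inp out \<and> m 5 = d)
     (loopc 5
         (seqc (block ([Sub 5 5 2] @ load_list 9 [20, 21, 22, 23, 24, 25] @ [Const 8 0, Const 10 32, Copy 6 3]))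
           (seqc (loopc 6 (block (inner_block e))) (block [Add 7 7 2]))))
     (d * (16 + (d * (116 + 2) + 1 + 1) + 2) + 1) (outer_inv cs e out0 d)"
  proof (rule hoare_loop)
    fix i assume "i < d"
    then have i: "i < 7 * length cs + 1" by (simp add: d_def)
    \<comment> \<open>A row costs 16 steps to start, \<open>d\<close> inner rounds of 116 steps and
      two jumps, the last inner test and one increment.\<close>
    show "hoare (\<lambda>m inp out. outer_inv cs e out0 i m inp out \<and> m 5 = d - i)
      (seqc (block ([Sub 5 5 2] @ load_list 9 [20, 21, 22, 23, 24, 25] @ [Const 8 0, Const 10 32, Copy 6 3]))
           (seqc (loopc 6 (block (inner_block e))) (block [Add 7 7 2])))
      (16 + (d * (116 + 2) + 1 + 1)) (\<lambda>m inp out. outer_inv cs e out0 (Suc i) m inp out \<and> m 5 = d - Suc i)"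
      by (intro hoare_seq[OF row_start_correct[OF i, folded d_def]] hoare_seq[OF _ row_end] hoare_loop)
        (rule inner_correct[OF i, folded d_def])
  qed
  then have "hoare (\<lambda>m inp out. frame cs m \<and> out = out0) (write_matrix e)
     (3 + (d * (16 + (d * (116 + 2) + 1 + 1) + 2) + 1)) (outer_inv cs e out0 d)"
    unfolding write_matrix_def inner_block_def by (rule hoare_seq[OF init])
  then show ?thesis
    by (rule hoare_conseq) (simp_all add: outer_inv_def d_def)
qed

section \<open>The complete program and the theorem\<close>

lemma program_correct:
  fixes x :: sat3
  defines "cs \<equiv> clauses x"
  defines "d \<equiv> 7 * length cs + 1"
  defines "tm \<equiv> 3 + (d * (16 + (d * (116 + 2) + 1 + 1) + 2) + 1)" and "tv \<equiv> 2 + (d * 7 + 1)"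
  shows "hoare (\<lambda>m inp out. m = (\<lambda>_. 0) \<and> inp = sat3_code x \<and> out = []) program
     (18 + ((length cs * (105 + 2) + 1) + (9 + (tm + (tv + (tm + tv))))))
     (\<lambda>m inp out. out = d # concat (matrix_codes d d (entry cs 1) @ vector_codes d (target cs 1) @
        matrix_codes d d (entry cs 2) @ vector_codes d (target cs 2)))"
proof -
  have read: "hoare (\<lambda>m i out. read_inv cs 0 m i out \<and> m 5 = length cs) (loopc 5 (block clause_block))
      (length cs * (105 + 2) + 1) (read_inv cs (length cs))"
    by (rule hoare_loop) (rule clause_correct)
  \<comment> \<open>The earlier output \<open>out0\<close> is arbitrary, which allows the writing
    phases to be chained.\<close>
  have mat: "hoare (\<lambda>m inp out. frame cs m \<and> out = out0) (write_matrix e) tm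
     (\<lambda>m inp out. frame cs m \<and> out = out0 @ concat (matrix_codes d d (entry cs e)))" for e out0
    unfolding tm_def d_def by (rule matrix_correct)
  have vec1: "hoare (\<lambda>m i out. frame cs m \<and> out = out0) (write_vector 2 2) tv
      (\<lambda>m i out. frame cs m \<and> out = out0 @ concat (vector_codes d (target cs 1)))" for out0
    unfolding tv_def d_def by (rule vector_correct) (simp_all add: frame_def target_def)
  have vec2: "hoare (\<lambda>m i out. frame cs m \<and> out = out0) (write_vector 15 14) tv
      (\<lambda>m i out. frame cs m \<and> out = out0 @ concat (vector_codes d (target cs 2)))" for out0
    unfolding tv_def d_def by (rule vector_correct) (simp_all add: frame_def target_def)
  have "hoare (\<lambda>m inp out. m = (\<lambda>_. 0) \<and> inp = sat3_code x \<and> out = []) program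
     (18 + ((length cs * (105 + 2) + 1) + (9 + (tm + (tv + (tm + tv))))))
     (\<lambda>m inp out. frame cs m \<and> out = ((([d] @ concat (matrix_codes d d (entry cs 1))) @
        concat (vector_codes d (target cs 1))) @ concat (matrix_codes d d (entry cs 2))) @
        concat (vector_codes d (target cs 2)))"
    unfolding program_def
    by (rule hoare_seq[OF init_correct[of x, folded cs_def]] hoare_seq[OF read]
        hoare_seq[OF param_correct[of cs, folded d_def]] hoare_seq[OF mat] hoare_seq[OF vec1] vec2)+
  then show ?thesis
    by (rule hoare_conseq) simp_all
qed

theorem lemma2p3:
  shows "\<exists>T :: sat3 \<Rightarrow> exist_lis.
           polytime_computable sat3_instance sat3_size sat3_code is_lis_code T \<and>
           (\<forall>x. sat3_instance x \<longrightarrow>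
                  exist_lis_instance (T x) \<and>
                  lis_dim (T x) = 7 * sat3_size x + 1 \<and>
                  card (lis_solutions (T x)) = card (sat3_solutions x))"
proof (intro exI[of _ reduction] conjI allI impI)
  show "polytime_computable sat3_instance sat3_size sat3_code is_lis_code reduction"
    unfolding polytime_computable_def
  \<comment> \<open>With \<open>d = 7 k + 1\<close> the time bound of the program is
    \<open>11564 k^2 + 3789 k + 332\<close>; the polynomial rounds up each coefficient.\<close>
  proof (intro exI[of _ "program 0"] exI[of _ "[:400, 4000, 12000:]"] allI impI)
    fix x :: sat3
    let ?d = "7 * length (clauses x) + 1"
    let ?out = "?d # concat (matrix_codes ?d ?d (entry (clauses x) 1) @ vector_codes ?d (target (clauses x) 1) @
        matrix_codes ?d ?d (entry (clauses x) 2) @ vector_codes ?d (target (clauses x) 2))"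
    have "computes_within (program 0) (sat3_code x) (poly [:400, 4000, 12000:] (sat3_size x)) ?out"
      by (rule hoare_computes[OF program_correct]) (simp add: sat3_size_def algebra_simps)
    moreover have "is_lis_code (reduction x) ?out"
      unfolding reduction_def by (rule is_lis_code_of_nats)
    ultimately show "\<exists>output. computes_within (program 0) (sat3_code x)
        (poly [:400, 4000, 12000:] (sat3_size x)) output \<and> is_lis_code (reduction x) output"
      by blast
  qed
  fix x :: sat3 assume "sat3_instance x"
  then show "card (lis_solutions (reduction x)) = card (sat3_solutions x)"
    by (rule card_lis_solutions_reduction)
  show "exist_lis_instance (reduction x)" by (rule reduction_instance)
  show "lis_dim (reduction x) = 7 * sat3_size x + 1"
    by (simp add: reduction_def lis_of_nats_def sat3_size_def)
qed

end
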